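(* Let $S=S_q=\{x\in\mathbb F_q^d: Q(x)=0\}$ with $Q=Q_q$ a non-degenerate quadratic form in $d$ variables over $\mathbb F_q$, and let $R^*(p\to r)$ be the associated extension constants. (i) If $d\ge 3$ is odd, then $R^*\left(2\to \frac{2d+2}{d-1}\right)\lesssim 1$. (ii) If $d\ge 4$ is even, then $R^*\left(2\to \frac{2d}{d-2}\right)\lesssim 1$. (iii) There exist specific varieties $S$ for which each of these results is a sharp $L^2$–$L^r$ extension estimate. That is, for each odd $d\ge 3$ there is a choice, for every odd prime power $q$, of a non-degenerate quadratic form over $\mathbb F_q$ in $d$ variables such that for the corresponding varieties $R^*(2\to r)\lesssim 1$ fails for every $1\le r<\frac{2d+2}{d-1}$; and for each even $d\ge 4$ there is such a choice for which $R^*(2\to r)\lesssim 1$ fails for every $1\le r<\frac{2d}{d-2}$.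
   Context: Throughout, $q$ is a power of an odd prime, $\mathbb F_q$ is the field with $q$ elements, and $\chi:\mathbb F_q\to\mathbb C$ is a fixed non-trivial additive character. Two copies of $\mathbb F_q^d$ are used: $(\mathbb F_q^d,dm)$ with counting measure, so $\|g\|_{L^r(\mathbb F_q^d,dm)}=\left(\sum_m|g(m)|^r\right)^{1/r}$ (maximum if $r=\infty$), and its dual $(\mathbb F_q^d,dx)$ with normalized counting measure (total mass $1$). A non-degenerate quadratic form $Q$ can be brought by a non-singular linear substitution to the form $a_1x_1^2+\cdots+a_dx_d^2$ with all $a_j\in\mathbb F_q\setminus\{0\}$; one may equivalently take $S=\{x\in\mathbb F_q^d: a_1x_1^2+\cdots+a_dx_d^2=0\}$. The normalized surface measure $d\sigma$ on $S$ is given by $\int_S f\,d\sigma=\frac1{|S|}\sum_{x\in S}f(x)$, and $\|f\|_{L^p(S,d\sigma)}=\left(\frac1{|S|}\sum_{x\in S}|f(x)|^p\right)^{1/p}$ (maximum if $p=\infty$). For $f:S\to\mathbb C$ the extension operator is $(f\,d\sigma)^\vee(m)=\frac1{|S|}\sum_{x\in S}\chi(x\cdot m)f(x)$, $m\in\mathbb F_q^d$. For $1\le p,r\le\infty$, $R^*(p\to r)$ is the smallest constant such that $\|(f\,d\sigma)^\vee\|_{L^r(\mathbb F_q^d,dm)}\le R^*(p\to r)\,\|f\|_{L^p(S,d\sigma)}$ for all $f:S\to\mathbb C$. Here $R^*(p\to r)\lesssim 1$ means that $R^*(p\to r)\le C$ with $C$ independent of $q$ (and of the choice of the form over $\mathbb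 F_q$ when no specific choice is made); $C$ may depend on $d,p,r$. For a specific choice of one form for each $q$, "$R^*(p\to r)\lesssim1$ fails" means that the supremum over $q$ of the corresponding constants is infinite. *)

theory Defs
  imports "HOL-Algebra.Ring" "HOL-Number_Theory.Prime_Powers"
    "HOL-Library.FuncSet" "HOL-Library.Extended_Real"
begin

text \<open>
  The constants in the estimates have to be uniform over all finite fields of odd characteristic,
  so fields are values (ring records) rather than types.
\<close>

definition odd_prime_power :: "nat \<Rightarrow> bool" where
  "odd_prime_power q \<longleftrightarrow> primepow q \<and> odd q"

definition finite_field :: "nat \<Rightarrow> ('a, 'b) ring_scheme \<Rightarrow> bool" where
  "finite_field q K \<longleftrightarrow> field K \<and> finite (carrier K) \<and> card (carrier K) = q"

definition nontrivial_additive_character ::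
    "('a, 'b) ring_scheme \<Rightarrow> ('a \<Rightarrow> complex) \<Rightarrow> bool" where
  "nontrivial_additive_character K \<chi> \<longleftrightarrow>
     (\<forall>s\<in>carrier K. cmod (\<chi> s) = 1) \<and>
     (\<forall>s\<in>carrier K. \<forall>t\<in>carrier K. \<chi> (s \<oplus>\<^bsub>K\<^esub> t) = \<chi> s * \<chi> t) \<and>
     (\<exists>s\<in>carrier K. \<chi> s \<noteq> 1)"

text \<open>
  Vectors of length \<open>d\<close> over \<open>K\<close> are extensional functions on \<open>{..<d}\<close>, so
  coordinates are numbered from \<open>0\<close> and equality of vectors is equality of functions.
\<close>

definition vecs :: "('a, 'b) ring_scheme \<Rightarrow> nat \<Rightarrow> (nat \<Rightarrow> 'a) set" where
  "vecs K d = {..<d} \<rightarrow>\<^sub>E carrier K"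

definition vec_zero :: "('a, 'b) ring_scheme \<Rightarrow> nat \<Rightarrow> nat \<Rightarrow> 'a" where
  "vec_zero K d = (\<lambda>i\<in>{..<d}. \<zero>\<^bsub>K\<^esub>)"

definition vec_add ::
    "('a, 'b) ring_scheme \<Rightarrow> nat \<Rightarrow> (nat \<Rightarrow> 'a) \<Rightarrow> (nat \<Rightarrow> 'a) \<Rightarrow> nat \<Rightarrow> 'a" where
  "vec_add K d x y = (\<lambda>i\<in>{..<d}. x i \<oplus>\<^bsub>K\<^esub> y i)"

definition dot ::
    "('a, 'b) ring_scheme \<Rightarrow> nat \<Rightarrow> (nat \<Rightarrow> 'a) \<Rightarrow> (nat \<Rightarrow> 'a) \<Rightarrow> 'a" where
  "dot K d x y = (\<Oplus>\<^bsub>K\<^esub>i\<in>{..<d}. x i \<otimes>\<^bsub>K\<^esub> y i)"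

definition quadratic_form ::
    "('a, 'b) ring_scheme \<Rightarrow> nat \<Rightarrow> ((nat \<Rightarrow> 'a) \<Rightarrow> 'a) \<Rightarrow> bool" where
  "quadratic_form K d Q \<longleftrightarrow>
     (\<exists>c. (\<forall>i<d. \<forall>j<d. c i j \<in> carrier K) \<and>
          (\<forall>x\<in>vecs K d. Q x =
             (\<Oplus>\<^bsub>K\<^esub>i\<in>{..<d}. \<Oplus>\<^bsub>K\<^esub>j\<in>{..<d}. c i j \<otimes>\<^bsub>K\<^esub> x i \<otimes>\<^bsub>K\<^esub> x j)))"

definition polar_form ::
    "('a, 'b) ring_scheme \<Rightarrow> nat \<Rightarrow> ((nat \<Rightarrow> 'a) \<Rightarrow> 'a) \<Rightarrow> (nat \<Rightarrow> 'a) \<Rightarrow> (nat \<Rightarrow> 'a) \<Rightarrow> 'a" where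
  "polar_form K d Q x y = Q (vec_add K d x y) \<ominus>\<^bsub>K\<^esub> Q x \<ominus>\<^bsub>K\<^esub> Q y"

text \<open>
  The polar form is twice the symmetric bilinear form of \<open>Q\<close>; in odd characteristic both have
  the same radical.
\<close>

definition nondegenerate_quadratic_form ::
    "('a, 'b) ring_scheme \<Rightarrow> nat \<Rightarrow> ((nat \<Rightarrow> 'a) \<Rightarrow> 'a) \<Rightarrow> bool" where
  "nondegenerate_quadratic_form K d Q \<longleftrightarrow> quadratic_form K d Q \<and>
     (\<forall>x\<in>vecs K d. (\<forall>y\<in>vecs K d. polar_form K d Q x y = \<zero>\<^bsub>K\<^esub>) \<longrightarrow> x = vec_zero K d)"

definition variety ::
    "('a, 'b) ring_scheme \<Rightarrow> nat \<Rightarrow> ((nat \<Rightarrow> 'a) \<Rightarrow> 'a) \<Rightarrow> (nat \<Rightarrow> 'a) set" where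
  "variety K d Q = {x \<in> vecs K d. Q x = \<zero>\<^bsub>K\<^esub>}"

text \<open>
  Exponents are extended reals in \<open>[1, \<infinity>]\<close>; both norms are used on finite nonempty sets only.
\<close>

definition counting_norm :: "ereal \<Rightarrow> 'v set \<Rightarrow> ('v \<Rightarrow> complex) \<Rightarrow> real" where
  "counting_norm r A g =
     (if r = \<infinity> then Max ((\<lambda>m. cmod (g m)) ` A)
      else (\<Sum>m\<in>A. cmod (g m) powr real_of_ereal r) powr (1 / real_of_ereal r))"

definition normalized_norm :: "ereal \<Rightarrow> 'v set \<Rightarrow> ('v \<Rightarrow> complex) \<Rightarrow> real" where
  "normalized_norm p S f =
     (if p = \<infinity> then Max ((\<lambda>x. cmod (f x)) ` S)
      else (1 / real (card S) * (\<Sum>x\<in>S. cmod (f x) powr real_of_ereal p))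
             powr (1 / real_of_ereal p))"

definition extension_operator ::
    "('a, 'b) ring_scheme \<Rightarrow> ('a \<Rightarrow> complex) \<Rightarrow> nat \<Rightarrow> (nat \<Rightarrow> 'a) set \<Rightarrow>
     ((nat \<Rightarrow> 'a) \<Rightarrow> complex) \<Rightarrow> (nat \<Rightarrow> 'a) \<Rightarrow> complex" where
  "extension_operator K \<chi> d S f m =
     1 / of_nat (card S) * (\<Sum>x\<in>S. \<chi> (dot K d x m) * f x)"

text \<open>
  The functions \<open>f\<close> range over all functions on \<open>nat \<Rightarrow> 'a\<close>, but only their values on \<open>S\<close> enter.
  The infimum is taken in the extended reals, so an empty set of admissible constants would give
  \<open>\<infinity>\<close>.
\<close>

definition extension_constant ::
    "('a, 'b) ring_scheme \<Rightarrow> ('a \<Rightarrow> complex) \<Rightarrow> nat \<Rightarrow> (nat \<Rightarrow> 'a) set \<Rightarrow>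
     ereal \<Rightarrow> ereal \<Rightarrow> ereal" where
  "extension_constant K \<chi> d S p r =
     Inf (ereal ` {C. 0 \<le> C \<and> (\<forall>f. counting_norm r (vecs K d) (extension_operator K \<chi> d S f)
                               \<le> C * normalized_norm p S f)})"

end

theory Submission
  imports Defs "HOL-Algebra.Module" "HOL-Algebra.Multiplicative_Group" "HOL-Analysis.L2_Norm"
begin

text \<open>
  Put \<open>e = d div 2\<close> and \<open>k = d - 1 - e\<close>; both critical exponents equal \<open>2 (k + 1) / k\<close>. The sum of
  \<open>\<chi> (x \<cdot> m)\<close> over \<open>x \<in> S\<close> is \<open>1/q\<close> times the sum over \<open>s\<close> of \<open>\<Sum>\<^sub>x \<chi> (s Q x + x \<cdot> m)\<close>. For \<open>s \<noteq> 0\<close> the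
  latter has modulus \<open>q\<^bsup>d/2\<^esup>\<close>; for odd \<open>d\<close> it changes sign with the quadratic character of \<open>s\<close>,
  which saves another factor \<open>\<surd>q\<close> in the sum over \<open>s\<close>. Hence the sum over \<open>S\<close> differs from
  \<open>q\<^bsup>d-1\<^esup> [m = 0]\<close> by at most \<open>q\<^sup>e\<close>, that is, the Fourier transform of \<open>d\<sigma>\<close> decays like \<open>q\<^bsup>-k\<^esup>\<close>.
  The Stein-Tomas argument interpolates the \<open>L\<^sup>1 \<rightarrow> L\<^sup>\<infinity>\<close> bound \<open>q\<^bsup>-k\<^esup>\<close> with the \<open>L\<^sup>2 \<rightarrow> L\<^sup>2\<close> bound \<open>q\<close>.
  For sharpness, the indicator function of a totally isotropic subspace of dimension \<open>e\<close> has
  constant extension on a subspace of dimension \<open>d - e\<close>.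
\<close>

section \<open>Character sums over quadratic spaces\<close>

text \<open>The exponents balance with no room to spare: a kernel bound of order
  \<open>q powr (- k)\<close> with weight \<open>1 / (k + 1)\<close> against an L2 bound of order
  \<open>q\<close> with weight \<open>k / (k + 1)\<close> gives \<open>q\<close> to the power 0, at
  the dual exponent \<open>p = 2 * (k + 1) / (k + 2)\<close>. Hence not even a logarithm may be lost
  in the interpolation. The kernel equals 1 on the diagonal and does not decay there, so the
  diagonal is removed first and paid for by the embedding of l^p into l^2. For odd \<open>d\<close>
  the change of sign is obtained without diagonalising the form: a vector with
  \<open>Q v \<noteq> \<zero>\<close> is split off and the argument continues in its orthogonal
  complement. This is why quadratic spaces are abstract modules with an induction over submodules.
  Comparison with the one-variable form then leaves a sum that can be evaluated exactly. In the
  sharpness example the lower bound is of order \<open>q powr ((k + 1) / r - k / 2)\<close>, whose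
  exponent is positive precisely for \<open>r < 2 * (k + 1) / k\<close>.\<close>

locale char_field = field K for K (structure) +
  fixes \<chi> :: "'a \<Rightarrow> complex"
  assumes finite_K [simp]: "finite (carrier K)"
    and odd_card: "odd (card (carrier K))"
    and character: "nontrivial_additive_character K \<chi>"
begin

abbreviation (input) "q \<equiv> card (carrier K)"

lemma carrier_nonempty [simp]: "carrier K \<noteq> {}"
  using zero_closed by blast

lemma q_pos: "q > 0"
  using odd_card by (cases q) auto

lemma q_ge_3: "q \<ge> 3"
proof -
  have "card {\<zero>, \<one>} \<le> q" by (rule card_mono) auto
  with odd_card show ?thesis by (cases "q = 2") auto
qed

lemma norm_chi [simp]: "s \<in> carrier K \<Longrightarrow> cmod (\<chi> s) = 1"
  using character by (simp add: nontrivial_additive_character_def)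

lemma chi_add: "s \<in> carrier K \<Longrightarrow> t \<in> carrier K \<Longrightarrow> \<chi> (s \<oplus> t) = \<chi> s * \<chi> t"
  using character by (simp add: nontrivial_additive_character_def)

lemma chi_zero [simp]: "\<chi> \<zero> = 1"
  by (metis chi_add l_zero mult_cancel_right1 norm_chi norm_zero zero_closed zero_neq_one)

lemma chi_nontrivial: obtains s where "s \<in> carrier K" "\<chi> s \<noteq> 1"
  using character by (auto simp: nontrivial_additive_character_def)

text \<open>The additive group has order \<open>q\<close>, so \<open>q\<close> times
  \<open>\<one>\<close> vanishes; as \<open>q\<close> is odd, a vanishing
  \<open>\<one> \<oplus> \<one>\<close> would leave \<open>\<one> = \<zero>\<close>.\<close>

lemma two_nonzero: "\<one> \<oplus> \<one> \<noteq> \<zero>"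
proof
  assume "\<one> \<oplus> \<one> = \<zero>"
  then have "[(2::nat)] \<cdot> \<one> = \<zero>"
    by (simp add: numeral_2_eq_2)
  moreover have "[q] \<cdot> \<one> = \<zero>"
    using add.pow_order_eq_1[of \<one>] by (simp add: order_def)
  moreover obtain k where "q = 2 * k + 1" using odd_card by (auto elim: oddE)
  ultimately have "\<one> = \<zero>"
    by (simp add: add.nat_pow_mult [symmetric] add.nat_pow_pow [symmetric])
  then show False by simp
qed

lemma nonzero_inv: "s \<in> carrier K \<Longrightarrow> s \<noteq> \<zero> \<Longrightarrow> inv s \<in> carrier K - {\<zero>} \<and> s \<otimes> inv s = \<one> \<and> inv s \<otimes> s = \<one>"
  by (metis Diff_iff Units_inv_closed Units_l_inv Units_r_inv field_Units insertE insert_iff l_null one_not_zero singletonD Units_closed)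

lemma bij_betw_mult:
  assumes "s \<in> carrier K" "s \<noteq> \<zero>"
  shows "bij_betw (\<lambda>t. s \<otimes> t) (carrier K) (carrier K)"
proof (rule bij_betwI[where g = "\<lambda>t. inv s \<otimes> t"])
  note i = nonzero_inv[OF assms]
  show "inv s \<otimes> (s \<otimes> x) = x" if "x \<in> carrier K" for x
    using that i assms by (simp add: m_assoc [symmetric])
  show "s \<otimes> (inv s \<otimes> x) = x" if "x \<in> carrier K" for x
    using that i assms by (simp add: m_assoc [symmetric])
qed (use assms nonzero_inv[OF assms] in auto)

lemma bij_betw_inv: "bij_betw (\<lambda>s. inv s) (carrier K - {\<zero>}) (carrier K - {\<zero>})"
proof (rule bij_betwI[where g = "\<lambda>s. inv s"])
  show "inv (inv x) = x" if "x \<in> carrier K - {\<zero>}" for x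
    using that field_Units by (metis Units_inv_inv)
  then show "inv (inv x) = x" if "x \<in> carrier K - {\<zero>}" for x
    using that by blast
qed (use nonzero_inv in auto)

text \<open>A translation by \<open>a\<close> multiplies the sum by \<open>\<chi> (\<phi> a) \<noteq> 1\<close>.\<close>

lemma sum_chi_linear:
  assumes M: "module K M" and fin: "finite (carrier M)"
    and \<phi>: "\<And>x. x \<in> carrier M \<Longrightarrow> \<phi> x \<in> carrier K"
    and add: "\<And>x y. x \<in> carrier M \<Longrightarrow> y \<in> carrier M \<Longrightarrow> \<phi> (x \<oplus>\<^bsub>M\<^esub> y) = \<phi> x \<oplus> \<phi> y"
    and smult: "\<And>t x. t \<in> carrier K \<Longrightarrow> x \<in> carrier M \<Longrightarrow> \<phi> (t \<odot>\<^bsub>M\<^esub> x) = t \<otimes> \<phi> x"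
    and b: "b \<in> carrier M" "\<phi> b \<noteq> \<zero>"
  shows "(\<Sum>x\<in>carrier M. \<chi> (\<phi> x)) = 0"
proof -
  interpret M: module K M by (rule M)
  obtain s where s: "s \<in> carrier K" "\<chi> s \<noteq> 1" by (rule chi_nontrivial)
  define a where "a = (s \<otimes> inv (\<phi> b)) \<odot>\<^bsub>M\<^esub> b"
  have i: "inv (\<phi> b) \<in> carrier K" "inv (\<phi> b) \<otimes> \<phi> b = \<one>"
    using nonzero_inv[OF \<phi>] b by auto
  have a: "a \<in> carrier M" "\<phi> a = s"
    using b s i smult[of "s \<otimes> inv (\<phi> b)" b] \<phi>[of b] by (simp_all add: a_def m_assoc)
  have "bij_betw (\<lambda>x. a \<oplus>\<^bsub>M\<^esub> x) (carrier M) (carrier M)"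
    using a by (intro bij_betwI[where g = "\<lambda>x. \<ominus>\<^bsub>M\<^esub> a \<oplus>\<^bsub>M\<^esub> x"]) (auto simp: M.r_neg1 M.r_neg2)
  then have "(\<Sum>x\<in>carrier M. \<chi> (\<phi> x)) = (\<Sum>x\<in>carrier M. \<chi> (\<phi> (a \<oplus>\<^bsub>M\<^esub> x)))"
    by (rule sum.reindex_bij_betw[symmetric])
  also have "\<dots> = \<chi> s * (\<Sum>x\<in>carrier M. \<chi> (\<phi> x))"
    using a s by (simp add: add chi_add \<phi> sum_distrib_left)
  finally show ?thesis using s(2) by simp
qed

lemma sum_chi_field:
  assumes c: "c \<in> carrier K"
  shows "(\<Sum>t\<in>carrier K. \<chi> (c \<otimes> t)) = (if c = \<zero> then of_nat q else 0)"
proof (cases "c = \<zero>")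
  case False
  obtain s where s: "s \<in> carrier K" "\<chi> s \<noteq> 1" by (rule chi_nontrivial)
  define a where "a = inv c \<otimes> s"
  have a: "a \<in> carrier K" "c \<otimes> a = s"
    using c s nonzero_inv[OF c False] by (simp_all add: a_def m_assoc[symmetric])
  have "bij_betw (\<lambda>x. a \<oplus> x) (carrier K) (carrier K)"
    using a by (intro bij_betwI[where g = "\<lambda>x. \<ominus> a \<oplus> x"]) (auto simp: r_neg1 r_neg2)
  then have "(\<Sum>x\<in>carrier K. \<chi> (c \<otimes> x)) = (\<Sum>x\<in>carrier K. \<chi> (c \<otimes> (a \<oplus> x)))"
    by (rule sum.reindex_bij_betw[symmetric])
  also have "\<dots> = \<chi> s * (\<Sum>x\<in>carrier K. \<chi> (c \<otimes> x))"
    using a s c by (simp add: r_distr chi_add sum_distrib_left)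
  finally show ?thesis using s(2) False by simp
qed simp

lemma sum_chi_nonzero:
  assumes c: "c \<in> carrier K"
  shows "(\<Sum>t\<in>carrier K - {\<zero>}. \<chi> (c \<otimes> t)) = (if c = \<zero> then of_nat q else 0) - 1"
  using sum_chi_field[OF c] c by (simp add: sum_diff1)

end

text \<open>Expanding the squared modulus and shifting one variable by the other leaves inner sums
  of \<open>\<beta>\<close>, of which only \<open>y = \<zero>\<close> survives. Here
  \<open>f\<close> is a quadratic phase and \<open>\<beta>\<close> its bicharacter; an abstract
  group lets the lemma serve both \<open>K\<close> and \<open>M\<close>.\<close>

lemma (in abelian_group) norm_sum_quadratic:
  fixes f :: "'a \<Rightarrow> complex"
  assumes fin: "finite (carrier G)"
    and quad: "\<And>x y. x \<in> carrier G \<Longrightarrow> y \<in> carrier G \<Longrightarrow> f (x \<oplus> y) * cnj (f x) = f y * \<beta> x y"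
    and orth: "\<And>y. y \<in> carrier G \<Longrightarrow> (\<Sum>x\<in>carrier G. \<beta> x y) = (if y = \<zero> then of_nat (card (carrier G)) else 0)"
    and zero: "f \<zero> = 1"
  shows "cmod (\<Sum>x\<in>carrier G. f x) = sqrt (card (carrier G))"
proof -
  let ?S = "\<Sum>x\<in>carrier G. f x"
  have tr: "bij_betw (\<lambda>y. x \<oplus> y) (carrier G) (carrier G)" if "x \<in> carrier G" for x
    using that by (intro bij_betwI[where g = "\<lambda>y. \<ominus> x \<oplus> y"]) (auto simp: r_neg1 r_neg2)
  have "?S * cnj ?S = (\<Sum>x\<in>carrier G. \<Sum>y\<in>carrier G. f y * cnj (f x))"
    by (subst sum.swap) (simp add: sum_product cnj_sum)
  also have "\<dots> = (\<Sum>x\<in>carrier G. \<Sum>y\<in>carrier G. f (x \<oplus> y) * cnj (f x))"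
    by (intro sum.cong refl sum.reindex_bij_betw[OF tr, symmetric])
  also have "\<dots> = (\<Sum>y\<in>carrier G. f y * (\<Sum>x\<in>carrier G. \<beta> x y))"
    by (subst sum.swap) (simp add: quad sum_distrib_left)
  also have "\<dots> = (\<Sum>y\<in>carrier G. if y = \<zero> then of_nat (card (carrier G)) else 0)"
    by (intro sum.cong refl) (simp add: orth zero)
  also have "\<dots> = of_nat (card (carrier G))"
    using fin by simp
  finally have "complex_of_real ((cmod ?S)\<^sup>2) = complex_of_real (card (carrier G))"
    by (simp only: complex_norm_square of_real_of_nat_eq)
  then have "(cmod ?S)\<^sup>2 = card (carrier G)"
    by (simp only: of_real_eq_iff)
  then show ?thesis by (metis norm_ge_zero real_sqrt_unique)
qed

section \<open>Gauss sums and their change of sign at nonsquares\<close>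

context char_field
begin

definition gauss_sum :: "'a \<Rightarrow> complex" where
  "gauss_sum c = (\<Sum>t\<in>carrier K. \<chi> (c \<otimes> (t \<otimes> t)))"

definition nonsquare :: "'a \<Rightarrow> bool" where
  "nonsquare s \<longleftrightarrow> s \<in> carrier K \<and> (\<forall>t\<in>carrier K. s \<noteq> t \<otimes> t)"

lemma nonsquareD: "nonsquare s \<Longrightarrow> s \<in> carrier K" "nonsquare s \<Longrightarrow> s \<noteq> \<zero>"
  unfolding nonsquare_def by (auto dest: bspec[of _ _ \<zero>])

lemma norm_gauss_sum:
  assumes c: "c \<in> carrier K" "c \<noteq> \<zero>"
  shows "cmod (gauss_sum c) = sqrt q"
  unfolding gauss_sum_def
\<comment> \<open>\<open>\<beta>\<close> comes from the cross term \<open>2cxy\<close> of the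
  square, which is nondegenerate because 2 is invertible.\<close>
proof (rule norm_sum_quadratic[where \<beta> = "\<lambda>x y. \<chi> ((\<one> \<oplus> \<one>) \<otimes> c \<otimes> y \<otimes> x)"])
  fix x y assume xy: "x \<in> carrier K" "y \<in> carrier K"
  have "c \<otimes> ((x \<oplus> y) \<otimes> (x \<oplus> y)) = c \<otimes> (x \<otimes> x) \<oplus> (c \<otimes> (y \<otimes> y) \<oplus> (\<one> \<oplus> \<one>) \<otimes> c \<otimes> y \<otimes> x)"
    using xy c by (simp add: l_distr r_distr m_ac a_ac)
  then have "\<chi> (c \<otimes> ((x \<oplus> y) \<otimes> (x \<oplus> y))) * cnj (\<chi> (c \<otimes> (x \<otimes> x)))
    = (\<chi> (c \<otimes> (x \<otimes> x)) * cnj (\<chi> (c \<otimes> (x \<otimes> x)))) * (\<chi> (c \<otimes> (y \<otimes> y)) * \<chi> ((\<one> \<oplus> \<one>) \<otimes> c \<otimes> y \<otimes> x))"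
    using xy c by (simp add: chi_add)
  moreover have "\<chi> (c \<otimes> (x \<otimes> x)) * cnj (\<chi> (c \<otimes> (x \<otimes> x))) = 1"
    using xy c by (simp flip: complex_norm_square)
  ultimately show "\<chi> (c \<otimes> ((x \<oplus> y) \<otimes> (x \<oplus> y))) * cnj (\<chi> (c \<otimes> (x \<otimes> x)))
    = \<chi> (c \<otimes> (y \<otimes> y)) * \<chi> ((\<one> \<oplus> \<one>) \<otimes> c \<otimes> y \<otimes> x)" by simp
next
  fix y assume y: "y \<in> carrier K"
  have "(\<one> \<oplus> \<one>) \<otimes> c \<otimes> y = \<zero> \<longleftrightarrow> y = \<zero>"
    using integral[of "(\<one> \<oplus> \<one>) \<otimes> c" y] integral[of "\<one> \<oplus> \<one>" c] two_nonzero c y by auto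
  then show "(\<Sum>x\<in>carrier K. \<chi> ((\<one> \<oplus> \<one>) \<otimes> c \<otimes> y \<otimes> x)) = (if y = \<zero> then of_nat q else 0)"
    using sum_chi_field[of "(\<one> \<oplus> \<one>) \<otimes> c \<otimes> y"] c y by simp
qed (use c in auto)

lemma square_eq_iff:
  assumes "t \<in> carrier K" "u \<in> carrier K"
  shows "t \<otimes> t = u \<otimes> u \<longleftrightarrow> t = u \<or> t = \<ominus> u"
proof
  assume eq: "t \<otimes> t = u \<otimes> u"
  have "(t \<ominus> u) \<otimes> (t \<oplus> u) = t \<otimes> t \<ominus> u \<otimes> u"
    using assms by algebra
  also have "\<dots> = \<zero>" using eq assms by (simp add: a_minus_def r_neg)
  finally consider "t \<ominus> u = \<zero>" | "t \<oplus> u = \<zero>"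
    using integral assms by blast
  then show "t = u \<or> t = \<ominus> u"
    using assms by cases (auto simp: minus_equality)
next
  assume "t = u \<or> t = \<ominus> u"
  then show "t \<otimes> t = u \<otimes> u"
    using assms by (auto simp: l_minus r_minus)
qed

lemma card_square_roots_le:
  assumes "u \<in> carrier K"
  shows "card {t \<in> carrier K. t \<otimes> t = u} \<le> 2"
proof (cases "\<exists>t\<in>carrier K. t \<otimes> t = u")
  case True
  then obtain t where t: "t \<in> carrier K" "t \<otimes> t = u" by blast
  then have "{t \<in> carrier K. t \<otimes> t = u} \<subseteq> {t, \<ominus> t}"
    using square_eq_iff by auto
  then have "card {t \<in> carrier K. t \<otimes> t = u} \<le> card {t, \<ominus> t}"
    by (rule card_mono[rotated]) simp
  also have "\<dots> \<le> 2" by (simp add: card_insert_if)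
  finally show ?thesis .
next
  case False
  then have "{t \<in> carrier K. t \<otimes> t = u} = {}" by blast
  then show ?thesis by (simp only: card.empty)
qed

text \<open>Every nonzero \<open>u\<close> has at most two representations as \<open>t\<^sup>2\<close> or \<open>s t\<^sup>2\<close>, and the
  total number of these representations is \<open>2 (q - 1)\<close>; so there are always exactly two.\<close>

lemma card_square_roots_nonsquare:
  assumes s: "nonsquare s" and u: "u \<in> carrier K"
  shows "card {t \<in> carrier K. t \<otimes> t = u} + card {t \<in> carrier K. s \<otimes> (t \<otimes> t) = u} = 2"
proof -
  note sK = nonsquareD[OF s]
  define n where "n u = card {t \<in> carrier K. t \<otimes> t = u}" for u
  define n' where "n' u = card {t \<in> carrier K. s \<otimes> (t \<otimes> t) = u}" for u
  have n'_eq: "n' u = n (inv s \<otimes> u)" if "u \<in> carrier K" for u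
  proof -
    have "s \<otimes> (t \<otimes> t) = u \<longleftrightarrow> t \<otimes> t = inv s \<otimes> u" if "t \<in> carrier K" for t
      using nonzero_inv[OF sK] sK that \<open>u \<in> carrier K\<close> by (metis DiffD1 l_one m_assoc m_closed)
    then show ?thesis unfolding n_def n'_def by (intro arg_cong[of _ _ card]) auto
  qed
  have le: "n u + n' u \<le> 2" if u: "u \<in> carrier K" for u
  proof (cases "n u = 0 \<or> n' u = 0")
    case True
    have "n u \<le> 2" "n' u \<le> 2"
      using card_square_roots_le[of u] card_square_roots_le[of "inv s \<otimes> u"] u sK n'_eq[OF u] nonzero_inv[OF sK]
      by (auto simp: n_def)
    with True show ?thesis by auto
  next
    case False
    then have "{t \<in> carrier K. t \<otimes> t = u} \<noteq> {}" "{t \<in> carrier K. s \<otimes> (t \<otimes> t) = u} \<noteq> {}"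
      unfolding n_def n'_def by (metis card.empty)+
    then obtain t t' where t: "t \<in> carrier K" "t \<otimes> t = u" "t' \<in> carrier K" "s \<otimes> (t' \<otimes> t') = u"
      by blast
    \<comment> \<open>A nonzero \<open>t'\<close> would exhibit \<open>s\<close> as the square of
      \<open>t \<otimes> inv t'\<close>. So both fibres are nonempty only over
      \<open>\<zero>\<close>, where each has one element.\<close>
    have "t' = \<zero>"
    proof (rule ccontr)
      assume "t' \<noteq> \<zero>"
      note i = nonzero_inv[OF t(3) this]
      have "s = s \<otimes> (t' \<otimes> t') \<otimes> (inv t' \<otimes> inv t')"
      proof -
        have "s \<otimes> (a \<otimes> a) \<otimes> (b \<otimes> b) = s \<otimes> ((a \<otimes> b) \<otimes> (a \<otimes> b))" if "a \<in> carrier K" "b \<in> carrier K" for a b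
          using that sK by (simp add: m_ac)
        from this[of t' "inv t'"] show ?thesis using i t sK by simp
      qed
      also have "\<dots> = (t \<otimes> inv t') \<otimes> (t \<otimes> inv t')"
        using t i by (auto simp: m_ac)
      finally show False using s t i by (auto simp: nonsquare_def)
    qed
    then have "u = \<zero>" using t sK by simp
    moreover have "{t \<in> carrier K. t \<otimes> t = \<zero>} = {\<zero>}" "{t \<in> carrier K. s \<otimes> (t \<otimes> t) = \<zero>} = {\<zero>}"
      using integral sK by (auto dest!: integral)
    ultimately show ?thesis by (simp add: n_def n'_def)
  qed
  have tot: "(\<Sum>u\<in>carrier K. card {t \<in> carrier K. g t = u}) = q" if "g ` carrier K \<subseteq> carrier K" for g
    using sum.group[OF finite_K finite_K that, of "\<lambda>_. 1::nat"] by simp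
  have "(\<Sum>u\<in>carrier K. n u) = q" unfolding n_def by (rule tot) auto
  moreover have "(\<Sum>u\<in>carrier K. n' u) = q" unfolding n'_def using sK by (intro tot) auto
  \<comment> \<open>Each of the two families of fibres has \<open>q\<close> points in total, so the
    deficits from 2 add up to 0; being natural numbers, they all vanish.\<close>
  ultimately have "(\<Sum>u\<in>carrier K. 2 - (n u + n' u)) = 0"
    using le by (simp add: sum_subtractf_nat sum.distrib)
  then have "2 - (n u + n' u) = 0" using u by simp
  with le[OF u] show ?thesis unfolding n_def n'_def by linarith
qed

text \<open>Grouped by the value \<open>u\<close> of the square, respectively of \<open>s\<close>
  times the square, the two Gauss sums together count every \<open>\<chi> (c \<otimes> u)\<close>
  twice, and this total vanishes by orthogonality.\<close>

lemma gauss_sum_nonsquare: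
  assumes s: "nonsquare s" and c: "c \<in> carrier K" "c \<noteq> \<zero>"
  shows "gauss_sum (s \<otimes> c) = - gauss_sum c"
proof -
  note sK = nonsquareD[OF s]
  have fib: "(\<Sum>t\<in>carrier K. \<chi> (c \<otimes> g t)) = (\<Sum>u\<in>carrier K. of_nat (card {t \<in> carrier K. g t = u}) * \<chi> (c \<otimes> u))"
    if g: "g ` carrier K \<subseteq> carrier K" for g
  proof -
    have "(\<Sum>t\<in>carrier K. \<chi> (c \<otimes> g t)) = (\<Sum>u\<in>carrier K. \<Sum>t\<in>{t \<in> carrier K. g t = u}. \<chi> (c \<otimes> g t))"
      by (rule sum.group[OF finite_K finite_K g, symmetric])
    also have "\<dots> = (\<Sum>u\<in>carrier K. \<Sum>t\<in>{t \<in> carrier K. g t = u}. \<chi> (c \<otimes> u))"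
      by (intro sum.cong refl) simp
    finally show ?thesis by simp
  qed
  have "gauss_sum (s \<otimes> c) = (\<Sum>t\<in>carrier K. \<chi> (c \<otimes> (s \<otimes> (t \<otimes> t))))"
    unfolding gauss_sum_def using sK c by (simp add: m_ac)
  also have "\<dots> = (\<Sum>u\<in>carrier K. of_nat (card {t \<in> carrier K. s \<otimes> (t \<otimes> t) = u}) * \<chi> (c \<otimes> u))"
    using sK by (intro fib) auto
  finally have "gauss_sum c + gauss_sum (s \<otimes> c)
    = (\<Sum>u\<in>carrier K. of_nat (card {t \<in> carrier K. t \<otimes> t = u} + card {t \<in> carrier K. s \<otimes> (t \<otimes> t) = u}) * \<chi> (c \<otimes> u))"
    using fib[of "\<lambda>t. t \<otimes> t"] by (auto simp: gauss_sum_def sum.distrib algebra_simps)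
  also have "\<dots> = (\<Sum>u\<in>carrier K. 2 * \<chi> (c \<otimes> u))"
    by (intro sum.cong refl) (simp add: card_square_roots_nonsquare[OF s] del: of_nat_add)
  also have "\<dots> = 0" using sum_chi_field[OF c(1)] c(2) by (simp flip: sum_distrib_left)
  finally show ?thesis by (simp add: eq_neg_iff_add_eq_0 add.commute)
qed

end

section \<open>Quadratic spaces and orthogonal splitting\<close>

locale quad_space = K?: char_field K \<chi> + module K M for K (structure) and \<chi> and M (structure) +
  fixes Q :: "'c \<Rightarrow> 'a" and B :: "'c \<Rightarrow> 'c \<Rightarrow> 'a"
  assumes finite_M [simp]: "finite (carrier M)"
    and Q_closed [simp]: "x \<in> carrier M \<Longrightarrow> Q x \<in> carrier K"
    and B_closed [simp]: "x \<in> carrier M \<Longrightarrow> y \<in> carrier M \<Longrightarrow> B x y \<in> carrier K"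
    and Q_add: "x \<in> carrier M \<Longrightarrow> y \<in> carrier M \<Longrightarrow> Q (x \<oplus>\<^bsub>M\<^esub> y) = Q x \<oplus> Q y \<oplus> B x y"
    and Q_smult: "t \<in> carrier K \<Longrightarrow> x \<in> carrier M \<Longrightarrow> Q (t \<odot>\<^bsub>M\<^esub> x) = t \<otimes> t \<otimes> Q x"
    and B_add: "x \<in> carrier M \<Longrightarrow> y \<in> carrier M \<Longrightarrow> z \<in> carrier M \<Longrightarrow> B (x \<oplus>\<^bsub>M\<^esub> y) z = B x z \<oplus> B y z"
    and B_smult: "t \<in> carrier K \<Longrightarrow> x \<in> carrier M \<Longrightarrow> y \<in> carrier M \<Longrightarrow> B (t \<odot>\<^bsub>M\<^esub> x) y = t \<otimes> B x y"
    and B_sym: "x \<in> carrier M \<Longrightarrow> y \<in> carrier M \<Longrightarrow> B x y = B y x"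
begin

text \<open>The radical is taken inside \<open>V\<close>, so that the notion passes to the
  orthogonal complements in the induction.\<close>

definition nondeg :: "'c set \<Rightarrow> bool" where
  "nondeg V \<longleftrightarrow> (\<forall>x\<in>V. (\<forall>y\<in>V. B x y = \<zero>) \<longrightarrow> x = \<zero>\<^bsub>M\<^esub>)"

definition quad_sum :: "'c set \<Rightarrow> 'a \<Rightarrow> complex" where
  "quad_sum V u = (\<Sum>x\<in>V. \<chi> (u \<otimes> Q x))"

lemma Q_zero [simp]: "Q \<zero>\<^bsub>M\<^esub> = \<zero>"
  using Q_smult[of \<zero> "\<zero>\<^bsub>M\<^esub>"] by simp

lemma B_zero_left [simp]: "y \<in> carrier M \<Longrightarrow> B \<zero>\<^bsub>M\<^esub> y = \<zero>"
  using B_smult[of \<zero> "\<zero>\<^bsub>M\<^esub>" y] by simp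

lemma B_zero_right [simp]: "y \<in> carrier M \<Longrightarrow> B y \<zero>\<^bsub>M\<^esub> = \<zero>"
  using B_sym[of y "\<zero>\<^bsub>M\<^esub>"] by simp

lemma B_add_right: "x \<in> carrier M \<Longrightarrow> y \<in> carrier M \<Longrightarrow> z \<in> carrier M \<Longrightarrow> B z (x \<oplus>\<^bsub>M\<^esub> y) = B z x \<oplus> B z y"
  using B_add[of x y z] by (simp add: B_sym[of z])

lemma B_smult_right: "t \<in> carrier K \<Longrightarrow> x \<in> carrier M \<Longrightarrow> y \<in> carrier M \<Longrightarrow> B y (t \<odot>\<^bsub>M\<^esub> x) = t \<otimes> B y x"
  using B_smult[of t x y] by (simp add: B_sym[of y])

text \<open>\<open>B\<close> is the full polarisation, so \<open>Q\<close> at twice \<open>v\<close>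
  gives \<open>4 Q v = 2 Q v + B v v\<close>. Since 2 is invertible, a vector with
  \<open>Q v \<noteq> \<zero>\<close> is not orthogonal to itself and can be split off.\<close>

lemma B_self:
  assumes v: "v \<in> carrier M"
  shows "B v v = (\<one> \<oplus> \<one>) \<otimes> Q v"
proof -
  have "(\<one> \<oplus> \<one>) \<odot>\<^bsub>M\<^esub> v = v \<oplus>\<^bsub>M\<^esub> v"
    using v by (simp add: smult_l_distr)
  then have "Q v \<oplus> Q v \<oplus> B v v = (\<one> \<oplus> \<one>) \<otimes> (\<one> \<oplus> \<one>) \<otimes> Q v"
    using Q_smult[of "\<one> \<oplus> \<one>" v] Q_add[of v v] v by simp
  also have "\<dots> = Q v \<oplus> Q v \<oplus> (\<one> \<oplus> \<one>) \<otimes> Q v"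
    using v by (simp add: l_distr r_distr K.a_ac)
  finally show ?thesis using v by simp
qed

text \<open>Projection along \<open>v\<close>: the coefficient has to be
  \<open>B x v \<otimes> inv (B v v)\<close>, where the inverse is available because
  \<open>B v v\<close> is twice \<open>Q v\<close>.\<close>

lemma bij_betw_orthogonal_split:
  assumes V: "submodule V K M" and v: "v \<in> V" "Q v \<noteq> \<zero>"
  shows "bij_betw (\<lambda>(w, t). w \<oplus>\<^bsub>M\<^esub> t \<odot>\<^bsub>M\<^esub> v) ({w \<in> V. B w v = \<zero>} \<times> carrier K) V"
proof -
  note VM = submoduleE[OF V]
  have vM: "v \<in> carrier M" using v VM(1) by auto
  have Bv: "B v v \<in> carrier K" "B v v \<noteq> \<zero>"
    using B_self[OF vM] vM v(2) two_nonzero by (auto dest: integral)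
  note i = nonzero_inv[OF Bv]
  show ?thesis
  proof (rule bij_betwI[where g = "\<lambda>x. (x \<oplus>\<^bsub>M\<^esub> (\<ominus> (B x v \<otimes> inv (B v v))) \<odot>\<^bsub>M\<^esub> v, B x v \<otimes> inv (B v v))"], goal_cases)
    case 1
    show ?case using VM v by (auto intro: VM(5))
  next
    case 2
    have "B (x \<oplus>\<^bsub>M\<^esub> (\<ominus> (B x v \<otimes> inv (B v v))) \<odot>\<^bsub>M\<^esub> v) v = \<zero>" if x: "x \<in> carrier M" for x
    proof -
      have "(B x v \<otimes> inv (B v v)) \<otimes> B v v = B x v"
        using x vM Bv i by (simp add: m_assoc)
      then show ?thesis
        using x vM Bv i by (simp add: B_add B_smult l_minus K.r_neg)
    qed
    then show ?case using VM(1) v i vM by (auto intro!: VM(4,5) K.a_inv_closed m_closed B_closed)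
  next
    case (3 x)
    then obtain w t where x: "x = (w, t)" "w \<in> V" "B w v = \<zero>" "t \<in> carrier K" by auto
    have wM: "w \<in> carrier M" using x VM(1) by auto
    have "B (w \<oplus>\<^bsub>M\<^esub> t \<odot>\<^bsub>M\<^esub> v) v \<otimes> inv (B v v) = t"
      using x wM vM Bv i by (simp add: B_add B_smult m_assoc)
    moreover have "w \<oplus>\<^bsub>M\<^esub> t \<odot>\<^bsub>M\<^esub> v \<oplus>\<^bsub>M\<^esub> (\<ominus> t) \<odot>\<^bsub>M\<^esub> v = w"
      using x wM vM by (simp add: smult_l_minus M.a_assoc M.r_neg)
    ultimately show ?case using x by simp
  next
    case (4 x)
    then have "x \<in> carrier M" using VM(1) by auto
    then show ?case
      using vM Bv i by (simp add: smult_l_minus M.a_assoc M.l_neg)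
  qed
qed

lemma submodule_orthogonal:
  assumes V: "submodule V K M" and v: "v \<in> V"
  shows "submodule {w \<in> V. B w v = \<zero>} K M"
proof -
  note VM = submoduleE[OF V]
  have vM: "v \<in> carrier M" using v VM(1) by auto
  show ?thesis
  proof (rule submoduleI)
    show "{w \<in> V. B w v = \<zero>} \<subseteq> carrier M" using VM(1) by auto
    show "\<zero>\<^bsub>M\<^esub> \<in> {w \<in> V. B w v = \<zero>}"
      using vM V by (simp add: submodule_def subgroup.one_closed[of V "add_monoid M", simplified])
    fix a assume a: "a \<in> {w \<in> V. B w v = \<zero>}"
    then have aM: "a \<in> carrier M" using VM(1) by auto
    have "\<ominus>\<^bsub>M\<^esub> a = (\<ominus> \<one>) \<odot>\<^bsub>M\<^esub> a" using aM by (simp add: smult_l_minus)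
    then show "\<ominus>\<^bsub>M\<^esub> a \<in> {w \<in> V. B w v = \<zero>}"
      using a aM vM VM by (auto simp: B_smult)
  next
    fix a b assume "a \<in> {w \<in> V. B w v = \<zero>}" "b \<in> {w \<in> V. B w v = \<zero>}"
    moreover from this have "a \<in> carrier M" "b \<in> carrier M" using VM(1) by auto
    ultimately show "a \<oplus>\<^bsub>M\<^esub> b \<in> {w \<in> V. B w v = \<zero>}"
      using vM VM by (auto simp: B_add)
  next
    fix a x assume "a \<in> carrier K" "x \<in> {w \<in> V. B w v = \<zero>}"
    moreover from this have "x \<in> carrier M" using VM(1) by auto
    ultimately show "a \<odot>\<^bsub>M\<^esub> x \<in> {w \<in> V. B w v = \<zero>}"
      using vM VM by (auto simp: B_smult)
  qed
qed

text \<open>For \<open>w\<close> orthogonal to \<open>v\<close> there is no cross term in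
  \<open>Q\<close>, so the sum factors and the line through \<open>v\<close> contributes a
  one-variable Gauss sum.\<close>

lemma quad_sum_split:
  assumes V: "submodule V K M" and v: "v \<in> V" "Q v \<noteq> \<zero>" and u: "u \<in> carrier K"
  shows "quad_sum V u = quad_sum {w \<in> V. B w v = \<zero>} u * gauss_sum (u \<otimes> Q v)"
proof -
  note VM = submoduleE[OF V]
  have vM: "v \<in> carrier M" using v VM(1) by auto
  let ?W = "{w \<in> V. B w v = \<zero>}"
  have "quad_sum V u = (\<Sum>(w, t)\<in>?W \<times> carrier K. \<chi> (u \<otimes> Q (w \<oplus>\<^bsub>M\<^esub> t \<odot>\<^bsub>M\<^esub> v)))"
    unfolding quad_sum_def
    by (subst sum.reindex_bij_betw[OF bij_betw_orthogonal_split[OF V v], symmetric]) (simp add: case_prod_unfold)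
  also have "\<dots> = (\<Sum>(w, t)\<in>?W \<times> carrier K. \<chi> (u \<otimes> Q w) * \<chi> (u \<otimes> Q v \<otimes> (t \<otimes> t)))"
  proof (intro sum.cong refl, clarify)
    fix w t assume w: "w \<in> V" "B w v = \<zero>" and t: "t \<in> carrier K"
    have wM: "w \<in> carrier M" using w VM(1) by auto
    have "u \<otimes> Q (w \<oplus>\<^bsub>M\<^esub> t \<odot>\<^bsub>M\<^esub> v) = u \<otimes> Q w \<oplus> u \<otimes> Q v \<otimes> (t \<otimes> t)"
      using u w t wM vM by (simp add: Q_add Q_smult B_smult_right r_distr m_ac)
    then show "\<chi> (u \<otimes> Q (w \<oplus>\<^bsub>M\<^esub> t \<odot>\<^bsub>M\<^esub> v)) = \<chi> (u \<otimes> Q w) * \<chi> (u \<otimes> Q v \<otimes> (t \<otimes> t))"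
      using u t wM vM by (simp add: chi_add)
  qed
  also have "\<dots> = quad_sum ?W u * gauss_sum (u \<otimes> Q v)"
    by (simp add: quad_sum_def gauss_sum_def sum_product sum.cartesian_product)
  finally show ?thesis .
qed

text \<open>Each step of an orthogonal splitting contributes one factor \<open>-1\<close>.\<close>

lemma quad_sum_nonsquare:
  assumes "submodule V K M" "nondeg V"
  shows "\<exists>n. card V = q ^ n \<and>
    (\<forall>s u. nonsquare s \<longrightarrow> u \<in> carrier K \<longrightarrow> u \<noteq> \<zero> \<longrightarrow> quad_sum V (s \<otimes> u) = (- 1) ^ n * quad_sum V u)"
  using assms
proof (induction "card V" arbitrary: V rule: less_induct)
  case less
  note V = less.prems(1) and VM = submoduleE[OF less.prems(1)]
  have fin: "finite V" using VM(1) finite_subset finite_M by blast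
  have zero: "\<zero>\<^bsub>M\<^esub> \<in> V"
    using V by (simp add: submodule_def subgroup.one_closed[of V "add_monoid M", simplified])
  show ?case
  proof (cases "\<forall>v\<in>V. Q v = \<zero>")
    \<comment> \<open>A vanishing \<open>Q\<close> forces a vanishing \<open>B\<close> through
      \<open>Q_add\<close>; nondegeneracy then leaves only the zero vector, the case of dimension
      0.\<close>
    case True
    have "B x y = \<zero>" if "x \<in> V" "y \<in> V" for x y
    proof -
      have "x \<in> carrier M" "y \<in> carrier M" using that VM(1) by auto
      then show ?thesis using Q_add[of x y] True that VM(5) by auto
    qed
    then have "V = {\<zero>\<^bsub>M\<^esub>}" using less.prems(2) zero unfolding nondeg_def by blast
    then show ?thesis
      by (intro exI[of _ 0]) (simp add: quad_sum_def nonsquareD)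
  next
    case False
    then obtain v where v: "v \<in> V" "Q v \<noteq> \<zero>" by blast
    have vM: "v \<in> carrier M" using v VM(1) by auto
    let ?W = "{w \<in> V. B w v = \<zero>}"
    note bij = bij_betw_orthogonal_split[OF V v]
    have card_V: "card V = q * card ?W"
      using bij_betw_same_card[OF bij] by (simp add: card_cartesian_product mult.commute)
    have "\<zero>\<^bsub>M\<^esub> \<in> ?W" using zero vM by simp
    then have "card ?W > 0" using fin by (auto simp: card_gt_0_iff)
    then have "card ?W < card V" using card_V q_ge_3 by simp
    \<comment> \<open>A vector of the complement that is orthogonal to the complement is also
      orthogonal to \<open>v\<close>, hence to all of \<open>V\<close> by the splitting.\<close>
    moreover have "nondeg ?W" unfolding nondeg_def
    proof (intro ballI impI)
      fix w assume w: "w \<in> ?W" "\<forall>y\<in>?W. B w y = \<zero>"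
      have wM: "w \<in> carrier M" using w VM(1) by auto
      have "B w x = \<zero>" if "x \<in> V" for x
      proof -
        have "x \<in> (\<lambda>(w, t). w \<oplus>\<^bsub>M\<^esub> t \<odot>\<^bsub>M\<^esub> v) ` (?W \<times> carrier K)"
          using bij_betw_imp_surj_on[OF bij] that by simp
        then obtain p where p: "x = (case p of (w, t) \<Rightarrow> w \<oplus>\<^bsub>M\<^esub> t \<odot>\<^bsub>M\<^esub> v)" "p \<in> ?W \<times> carrier K"
          by (rule imageE)
        obtain w' t where w': "p = (w', t)" by (cases p)
        then show ?thesis
          using p w wM vM subsetD[OF VM(1), of w'] by (simp add: w' B_add_right B_smult_right)
      qed
      then show "w = \<zero>\<^bsub>M\<^esub>" using less.prems(2) w by (auto simp: nondeg_def)
    qed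
    ultimately obtain n where n: "card ?W = q ^ n"
      "\<And>s u. nonsquare s \<Longrightarrow> u \<in> carrier K \<Longrightarrow> u \<noteq> \<zero> \<Longrightarrow> quad_sum ?W (s \<otimes> u) = (- 1) ^ n * quad_sum ?W u"
      using less.hyps[of ?W] submodule_orthogonal[OF V v(1)] by blast
    show ?thesis
    proof (intro exI[of _ "Suc n"] conjI allI impI)
      show "card V = q ^ Suc n" using card_V n(1) by simp
      fix s u assume su: "nonsquare s" "u \<in> carrier K" "u \<noteq> \<zero>"
      note sK = nonsquareD[OF su(1)]
      have "gauss_sum (s \<otimes> u \<otimes> Q v) = - gauss_sum (u \<otimes> Q v)"
        using gauss_sum_nonsquare[OF su(1), of "u \<otimes> Q v"] integral[of u "Q v"] su sK vM v
        by (auto simp: m_assoc)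
      then show "quad_sum V (s \<otimes> u) = (- 1) ^ Suc n * quad_sum V u"
        using su sK by (simp add: quad_sum_split[OF V v] n(2))
    qed
  qed
qed

lemma sum_chi_B:
  assumes nd: "nondeg (carrier M)" and y: "y \<in> carrier M" and u: "u \<in> carrier K" "u \<noteq> \<zero>"
  shows "(\<Sum>x\<in>carrier M. \<chi> (u \<otimes> B x y)) = (if y = \<zero>\<^bsub>M\<^esub> then of_nat (card (carrier M)) else 0)"
proof (cases "y = \<zero>\<^bsub>M\<^esub>")
  case False
  then obtain b where b: "b \<in> carrier M" "B y b \<noteq> \<zero>"
    using nd y by (auto simp: nondeg_def)
  then have "u \<otimes> B b y \<noteq> \<zero>" using u y by (auto simp: B_sym[of b y] dest: integral)
  then show ?thesis using False y u b
    by (simp, intro sum_chi_linear[where b = b])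
       (auto simp: B_add B_smult r_distr m_ac module_axioms)
qed (use u in simp)

lemma norm_quad_sum:
  assumes nd: "nondeg (carrier M)" and u: "u \<in> carrier K" "u \<noteq> \<zero>"
  shows "cmod (quad_sum (carrier M) u) = sqrt (card (carrier M))"
  unfolding quad_sum_def
proof (rule M.norm_sum_quadratic[where \<beta> = "\<lambda>x y. \<chi> (u \<otimes> B x y)"])
  fix x y assume xy: "x \<in> carrier M" "y \<in> carrier M"
  have "\<chi> (u \<otimes> Q x) * cnj (\<chi> (u \<otimes> Q x)) = 1"
    using xy u by (simp flip: complex_norm_square)
  then show "\<chi> (u \<otimes> Q (x \<oplus>\<^bsub>M\<^esub> y)) * cnj (\<chi> (u \<otimes> Q x)) = \<chi> (u \<otimes> Q y) * \<chi> (u \<otimes> B x y)"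
    using xy u by (simp add: Q_add r_distr chi_add)
qed (use u sum_chi_B[OF nd] in auto)

lemma quad_sum_square:
  assumes "s \<in> carrier K" "s \<noteq> \<zero>"
  shows "quad_sum (carrier M) (s \<otimes> s) = quad_sum (carrier M) \<one>"
proof -
  note i = nonzero_inv[OF assms]
  have "bij_betw (\<lambda>x. s \<odot>\<^bsub>M\<^esub> x) (carrier M) (carrier M)"
    by (rule bij_betwI[where g = "\<lambda>x. inv s \<odot>\<^bsub>M\<^esub> x"]) (use assms i in \<open>auto simp flip: smult_assoc1\<close>)
  then have "quad_sum (carrier M) \<one> = (\<Sum>x\<in>carrier M. \<chi> (\<one> \<otimes> Q (s \<odot>\<^bsub>M\<^esub> x)))"
    unfolding quad_sum_def by (rule sum.reindex_bij_betw[symmetric])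
  then show ?thesis using assms by (simp add: quad_sum_def Q_smult)
qed

lemma gauss_sum_square:
  assumes "s \<in> carrier K" "s \<noteq> \<zero>"
  shows "gauss_sum (s \<otimes> s) = gauss_sum \<one>"
proof -
  have "gauss_sum \<one> = (\<Sum>t\<in>carrier K. \<chi> (\<one> \<otimes> ((s \<otimes> t) \<otimes> (s \<otimes> t))))"
    unfolding gauss_sum_def by (rule sum.reindex_bij_betw[OF bij_betw_mult[OF assms], symmetric])
  also have "\<dots> = gauss_sum (s \<otimes> s)"
    unfolding gauss_sum_def using assms by (intro sum.cong refl) (simp add: m_ac)
  finally show ?thesis by simp
qed

text \<open>Relative to their values at \<open>\<one>\<close>, both sums equal the quadratic
  character of \<open>s\<close>: 1 at squares and, for odd \<open>n\<close>, -1 at nonsquares.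
  Cross-multiplication avoids defining that character and trades the sum in \<open>n\<close>
  variables for one in a single variable.\<close>

lemma quad_sum_odd:
  assumes nd: "nondeg (carrier M)" and n: "card (carrier M) = q ^ n" "odd n" and s: "s \<in> carrier K" "s \<noteq> \<zero>"
  shows "quad_sum (carrier M) s * gauss_sum \<one> = quad_sum (carrier M) \<one> * gauss_sum s"
proof (cases "nonsquare s")
  case True
  have "submodule (carrier M) K M" by (rule submoduleI) auto
  from quad_sum_nonsquare[OF this nd] obtain n' where n': "card (carrier M) = q ^ n'"
     "\<And>s u. nonsquare s \<Longrightarrow> u \<in> carrier K \<Longrightarrow> u \<noteq> \<zero> \<Longrightarrow> quad_sum (carrier M) (s \<otimes> u) = (- 1) ^ n' * quad_sum (carrier M) u"
    by blast
  \<comment> \<open>The induction knows the dimension only through the cardinality; injectivity of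
    powers of \<open>q\<close> recovers its parity.\<close>
  have "n' = n" using n' n q_ge_3 power_inject_exp[of q n' n] by simp
  then have "quad_sum (carrier M) s = - quad_sum (carrier M) \<one>"
    using n'(2)[OF True, of \<one>] n s by simp
  moreover have "gauss_sum s = - gauss_sum \<one>"
    using gauss_sum_nonsquare[OF True, of \<one>] s by simp
  ultimately show ?thesis by simp
next
  case False
  then obtain t where "t \<in> carrier K" "s = t \<otimes> t" using s by (auto simp: nonsquare_def)
  moreover from this have "t \<noteq> \<zero>" using s by auto
  ultimately show ?thesis using quad_sum_square gauss_sum_square by simp
qed

text \<open>Completing the square. As \<open>B\<close> is the full polarisation, the shift is
  \<open>y\<close> divided by \<open>s\<close>, without a factor 1/2, and it costs the constant
  \<open>inv s \<otimes> Q y\<close>.\<close>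

lemma quad_sum_linear:
  assumes y: "y \<in> carrier M" and s: "s \<in> carrier K" "s \<noteq> \<zero>"
  shows "(\<Sum>x\<in>carrier M. \<chi> (s \<otimes> Q x \<oplus> B x y)) = quad_sum (carrier M) s * \<chi> (\<ominus> (inv s \<otimes> Q y))"
proof -
  note i = nonzero_inv[OF s]
  let ?z = "inv s \<odot>\<^bsub>M\<^esub> y"
  have "bij_betw (\<lambda>x. ?z \<oplus>\<^bsub>M\<^esub> x) (carrier M) (carrier M)"
    using y i by (intro bij_betwI[where g = "\<lambda>x. \<ominus>\<^bsub>M\<^esub> ?z \<oplus>\<^bsub>M\<^esub> x"]) (auto simp: M.r_neg1 M.r_neg2)
  then have "quad_sum (carrier M) s = (\<Sum>x\<in>carrier M. \<chi> (s \<otimes> Q (?z \<oplus>\<^bsub>M\<^esub> x)))"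
    unfolding quad_sum_def by (rule sum.reindex_bij_betw[symmetric])
  also have "\<dots> = (\<Sum>x\<in>carrier M. \<chi> (s \<otimes> Q x \<oplus> B x y) * \<chi> (inv s \<otimes> Q y))"
  proof (rule sum.cong[OF refl])
    fix x assume x: "x \<in> carrier M"
    have c: "s \<otimes> (inv s \<otimes> a) = a" if "a \<in> carrier K" for a
      using i s that by (simp add: m_assoc[symmetric])
    have "s \<otimes> Q (?z \<oplus>\<^bsub>M\<^esub> x) = (s \<otimes> Q x \<oplus> B x y) \<oplus> inv s \<otimes> Q y"
      using x y s i by (simp add: Q_add Q_smult B_smult B_sym[of x y] r_distr m_assoc c K.a_ac)
    then show "\<chi> (s \<otimes> Q (?z \<oplus>\<^bsub>M\<^esub> x)) = \<chi> (s \<otimes> Q x \<oplus> B x y) * \<chi> (inv s \<otimes> Q y)"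
      using x y s i by (simp add: chi_add)
  qed
  finally have "quad_sum (carrier M) s * \<chi> (\<ominus> (inv s \<otimes> Q y)) =
    (\<Sum>x\<in>carrier M. \<chi> (s \<otimes> Q x \<oplus> B x y)) * (\<chi> (inv s \<otimes> Q y) * \<chi> (\<ominus> (inv s \<otimes> Q y)))"
    by (simp flip: sum_distrib_right)
  moreover have "\<chi> (inv s \<otimes> Q y) * \<chi> (\<ominus> (inv s \<otimes> Q y)) = 1"
    using y i by (simp flip: chi_add add: K.r_neg)
  ultimately show ?thesis by simp
qed

end

section \<open>The exponential sum over a quadric\<close>

context char_field
begin

text \<open>The substitution \<open>t \<mapsto> t / s\<close> makes the inner sum over \<open>s\<close> linear.\<close>

lemma norm_sum_gauss_sum_le:
  assumes c: "c \<in> carrier K"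
  shows "cmod (\<Sum>s\<in>carrier K - {\<zero>}. gauss_sum s * \<chi> (\<ominus> (inv s \<otimes> c))) \<le> q"
proof -
  let ?R = "{t \<in> carrier K. t \<otimes> t = c}"
  have "(\<Sum>s\<in>carrier K - {\<zero>}. gauss_sum s * \<chi> (\<ominus> (inv s \<otimes> c)))
    = (\<Sum>s\<in>carrier K - {\<zero>}. \<Sum>t\<in>carrier K. \<chi> ((t \<otimes> t \<ominus> c) \<otimes> inv s))"
  proof (rule sum.cong[OF refl])
    fix s assume "s \<in> carrier K - {\<zero>}"
    then have s: "s \<in> carrier K" "s \<noteq> \<zero>" by auto
    note i = nonzero_inv[OF s]
    have e: "s \<otimes> ((inv s \<otimes> t) \<otimes> (inv s \<otimes> t)) = inv s \<otimes> (t \<otimes> t)" if "t \<in> carrier K" for t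
    proof -
      have "s \<otimes> ((a \<otimes> t) \<otimes> (a \<otimes> t)) = (s \<otimes> a) \<otimes> (a \<otimes> (t \<otimes> t))" if "a \<in> carrier K" for a
        using s that \<open>t \<in> carrier K\<close> by (simp add: m_ac)
      from this[of "inv s"] show ?thesis using i that by simp
    qed
    have e': "(t \<otimes> t \<ominus> c) \<otimes> inv s = inv s \<otimes> (t \<otimes> t) \<oplus> \<ominus> (inv s \<otimes> c)" if "t \<in> carrier K" for t
      using i c that by (simp add: a_minus_def r_distr r_minus m_comm[of _ "inv s"])
    have "gauss_sum s = (\<Sum>t\<in>carrier K. \<chi> (s \<otimes> ((inv s \<otimes> t) \<otimes> (inv s \<otimes> t))))"
      unfolding gauss_sum_def by (rule sum.reindex_bij_betw[OF bij_betw_mult, symmetric]) (use i in auto)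
    then show "gauss_sum s * \<chi> (\<ominus> (inv s \<otimes> c)) = (\<Sum>t\<in>carrier K. \<chi> ((t \<otimes> t \<ominus> c) \<otimes> inv s))"
      using i c s by (simp add: e sum_distrib_right e' flip: chi_add cong: sum.cong)
  qed
  \<comment> \<open>For fixed \<open>t\<close> the inverse \<open>inv s\<close> runs through all
    nonzero elements, so the inner sum detects \<open>t \<otimes> t = c\<close> by
    orthogonality.\<close>
  also have "\<dots> = (\<Sum>t\<in>carrier K. \<Sum>s\<in>carrier K - {\<zero>}. \<chi> ((t \<otimes> t \<ominus> c) \<otimes> s))"
    by (subst sum.swap, rule sum.cong[OF refl], rule sum.reindex_bij_betw[OF bij_betw_inv])
  also have "\<dots> = (\<Sum>t\<in>carrier K. (if t \<otimes> t = c then of_nat q else 0) - 1)"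
    by (intro sum.cong refl) (use c in \<open>simp add: sum_chi_nonzero\<close>)
  also have "\<dots> = of_nat (card ?R) * of_nat q - of_nat q"
    by (simp add: sum_subtractf sum.If_cases Int_def)
  also have "\<dots> = of_int ((int (card ?R) - 1) * int q)"
    by (simp add: algebra_simps)
  finally have "cmod (\<Sum>s\<in>carrier K - {\<zero>}. gauss_sum s * \<chi> (\<ominus> (inv s \<otimes> c))) = \<bar>real (card ?R) - 1\<bar> * q"
    by (simp only: norm_of_int) (simp add: abs_mult)
  \<comment> \<open>\<open>c\<close> has 0, 1 or 2 square roots, so the count is within 1 of 1.
    Termwise estimation would give about \<open>q * sqrt q\<close>; the lost root is the saving in
    odd dimension.\<close>
  also have "\<dots> \<le> 1 * real q"
    using card_square_roots_le[OF c] by (intro mult_right_mono) auto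
  finally show ?thesis by simp
qed

end

context quad_space
begin

lemma norm_character_sum_quadric:
  assumes nd: "nondeg (carrier M)" and n: "card (carrier M) = q ^ n" "n > 0" and y: "y \<in> carrier M"
  shows "cmod ((\<Sum>x | x \<in> carrier M \<and> Q x = \<zero>. \<chi> (B x y)) - (if y = \<zero>\<^bsub>M\<^esub> then of_nat q ^ (n - 1) else 0))
    \<le> real q ^ (n div 2)"
proof -
  have q0: "real q > 0" using q_pos by simp
  define D where "D = (\<Sum>s\<in>carrier K - {\<zero>}. \<Sum>x\<in>carrier M. \<chi> (s \<otimes> Q x \<oplus> B x y))"
  define E where "E = (\<Sum>x | x \<in> carrier M \<and> Q x = \<zero>. \<chi> (B x y))"
  have D: "D = (\<Sum>s\<in>carrier K - {\<zero>}. quad_sum (carrier M) s * \<chi> (\<ominus> (inv s \<otimes> Q y)))"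
    unfolding D_def by (intro sum.cong refl) (use y in \<open>auto simp: quad_sum_linear\<close>)
  have norm_D: "cmod D \<le> q * real q ^ (n div 2)"
  proof (cases "even n")
    case True
    have "cmod D \<le> (\<Sum>s\<in>carrier K - {\<zero>}. sqrt (card (carrier M)))"
      unfolding D using y
      by (intro sum_norm_le) (use nonzero_inv in \<open>auto simp: norm_mult norm_quad_sum[OF nd]\<close>)
    also have "\<dots> \<le> (\<Sum>s\<in>carrier K. sqrt (card (carrier M)))"
      by (intro sum_mono2) auto
    also have "sqrt (card (carrier M)) = real q ^ (n div 2)"
      using True by (auto simp: n power_mult real_sqrt_power elim!: evenE)
    finally show ?thesis by simp
  next
    case False
    \<comment> \<open>The factor \<open>gauss_sum \<one>\<close> lets \<open>quad_sum_odd\<close>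
      pull \<open>quad_sum (carrier M) \<one>\<close> out of the sum over \<open>s\<close>. Its
      modulus \<open>sqrt q\<close> cancels at the end against the half power in
      \<open>sqrt (q ^ n)\<close> for odd \<open>n\<close>.\<close>
    have "D * gauss_sum \<one> = (\<Sum>s\<in>carrier K - {\<zero>}. quad_sum (carrier M) \<one> * (gauss_sum s * \<chi> (\<ominus> (inv s \<otimes> Q y))))"
      unfolding D sum_distrib_right
    proof (rule sum.cong[OF refl])
      fix s assume s: "s \<in> carrier K - {\<zero>}"
      have "quad_sum (carrier M) s * gauss_sum \<one> = quad_sum (carrier M) \<one> * gauss_sum s"
        using quad_sum_odd[OF nd n(1) False] s by simp
      from arg_cong[OF this, of "\<lambda>z. z * \<chi> (\<ominus> (inv s \<otimes> Q y))"]
      show "quad_sum (carrier M) s * \<chi> (\<ominus> (inv s \<otimes> Q y)) * gauss_sum \<one> =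
         quad_sum (carrier M) \<one> * (gauss_sum s * \<chi> (\<ominus> (inv s \<otimes> Q y)))"
        by (simp only: ac_simps)
    qed
    then have "cmod (D * gauss_sum \<one>) = cmod (quad_sum (carrier M) \<one> * (\<Sum>s\<in>carrier K - {\<zero>}. gauss_sum s * \<chi> (\<ominus> (inv s \<otimes> Q y))))"
      by (simp only: sum_distrib_left)
    then have "cmod D * sqrt q = sqrt (card (carrier M)) * cmod (\<Sum>s\<in>carrier K - {\<zero>}. gauss_sum s * \<chi> (\<ominus> (inv s \<otimes> Q y)))"
      by (simp only: norm_mult norm_gauss_sum norm_quad_sum[OF nd] one_closed one_not_zero not_False_eq_True)
    also have "\<dots> \<le> sqrt (card (carrier M)) * q"
      using y by (intro mult_left_mono norm_sum_gauss_sum_le) auto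
    also have "sqrt (card (carrier M)) = real q ^ (n div 2) * sqrt q"
      using False by (auto simp: n power_mult real_sqrt_power real_sqrt_mult elim!: oddE)
    finally show ?thesis using q0 by (simp add: mult_ac)
  qed
  \<comment> \<open>The sum over \<open>s\<close> is \<open>q\<close> on the quadric and 0 off
    it.\<close>
  have "of_nat q * E = (\<Sum>x\<in>carrier M. \<chi> (B x y) * (\<Sum>s\<in>carrier K. \<chi> (Q x \<otimes> s)))"
    unfolding E_def sum_distrib_left[of "of_nat q"]
    by (rule sum.mono_neutral_cong_left) (use y in \<open>auto simp: sum_chi_field\<close>)
  also have "\<dots> = (\<Sum>s\<in>carrier K. \<Sum>x\<in>carrier M. \<chi> (s \<otimes> Q x \<oplus> B x y))"
    by (subst sum.swap) (use y in \<open>simp add: sum_distrib_left chi_add m_comm mult_ac cong: sum.cong\<close>)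
  also have "\<dots> = (\<Sum>x\<in>carrier M. \<chi> (B x y)) + D"
    unfolding D_def by (subst sum.remove[of _ \<zero>]) (use y in \<open>auto intro!: sum.cong\<close>)
  \<comment> \<open>The term \<open>s = \<zero>\<close> is the main term; \<open>q ^ n\<close> is
    written as \<open>q * q ^ (n - 1)\<close> so that \<open>q\<close> can be cancelled.\<close>
  also have "(\<Sum>x\<in>carrier M. \<chi> (B x y)) = of_nat q * (if y = \<zero>\<^bsub>M\<^esub> then of_nat q ^ (n - 1) else 0)"
    using sum_chi_B[OF nd y, of \<one>] y n by (cases n) auto
  finally have "of_nat q * (E - (if y = \<zero>\<^bsub>M\<^esub> then of_nat q ^ (n - 1) else 0)) = D"
    by (simp add: algebra_simps)
  then have "q * cmod (E - (if y = \<zero>\<^bsub>M\<^esub> then of_nat q ^ (n - 1) else 0)) = cmod D"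
    by (metis norm_mult norm_of_nat)
  with norm_D have "real q * cmod (E - (if y = \<zero>\<^bsub>M\<^esub> then of_nat q ^ (n - 1) else 0)) \<le> real q * real q ^ (n div 2)"
    by simp
  with q0 show ?thesis unfolding E_def by (simp only: mult_le_cancel_left_pos)
qed

end

section \<open>Coordinates\<close>

lemma (in abelian_monoid) finsum_swap:
  assumes "finite A" "finite B" "\<And>i j. i \<in> A \<Longrightarrow> j \<in> B \<Longrightarrow> f i j \<in> carrier G"
  shows "(\<Oplus>i\<in>A. \<Oplus>j\<in>B. f i j) = (\<Oplus>j\<in>B. \<Oplus>i\<in>A. f i j)"
  using assms
proof (induction A rule: finite_induct)
  case (insert a A)
  then have "(\<Oplus>i\<in>insert a A. \<Oplus>j\<in>B. f i j) = (\<Oplus>j\<in>B. f a j) \<oplus> (\<Oplus>j\<in>B. \<Oplus>i\<in>A. f i j)"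
    by (subst finsum_insert) (auto simp: Pi_def intro!: finsum_closed)
  also have "\<dots> = (\<Oplus>j\<in>B. f a j \<oplus> (\<Oplus>i\<in>A. f i j))"
    using insert by (subst finsum_addf) (auto simp: Pi_def intro!: finsum_closed)
  also have "\<dots> = (\<Oplus>j\<in>B. \<Oplus>i\<in>insert a A. f i j)"
    using insert by (intro finsum_cong' refl) (auto simp: Pi_def intro!: finsum_closed finsum_insert[symmetric])
  finally show ?case .
qed simp

text \<open>The module record type extends the ring record, which is where the fields
  \<open>monoid.mult\<close> and \<open>one\<close> come from.\<close>

definition vec_module :: "('a, 'b) ring_scheme \<Rightarrow> nat \<Rightarrow> ('a, nat \<Rightarrow> 'a) module" where
  "vec_module K d = \<lparr>carrier = vecs K d, monoid.mult = undefined, one = undefined, zero = vec_zero K d,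
     add = vec_add K d, smult = (\<lambda>t x. \<lambda>i\<in>{..<d}. t \<otimes>\<^bsub>K\<^esub> x i)\<rparr>"

lemma vec_module_simps [simp]:
  "carrier (vec_module K d) = vecs K d"
  "zero (vec_module K d) = vec_zero K d"
  "add (vec_module K d) = vec_add K d"
  "smult (vec_module K d) t x = (\<lambda>i\<in>{..<d}. t \<otimes>\<^bsub>K\<^esub> x i)"
  by (simp_all add: vec_module_def)

definition unit_vec :: "('a, 'b) ring_scheme \<Rightarrow> nat \<Rightarrow> nat \<Rightarrow> nat \<Rightarrow> 'a" where
  "unit_vec K d i = (\<lambda>j\<in>{..<d}. if j = i then \<one>\<^bsub>K\<^esub> else \<zero>\<^bsub>K\<^esub>)"

lemma vecs_ext: "x \<in> vecs K d \<Longrightarrow> y \<in> vecs K d \<Longrightarrow> (\<And>i. i < d \<Longrightarrow> x i = y i) \<Longrightarrow> x = y"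
  unfolding vecs_def by (rule PiE_ext) auto

lemma vecs_nth [simp]: "x \<in> vecs K d \<Longrightarrow> i < d \<Longrightarrow> x i \<in> carrier K"
  unfolding vecs_def by auto

lemma restrict_in_vecs: "(\<And>i. i < d \<Longrightarrow> f i \<in> carrier K) \<Longrightarrow> (\<lambda>i\<in>{..<d}. f i) \<in> vecs K d"
  unfolding vecs_def by auto

lemma vec_add_nth [simp]: "i < d \<Longrightarrow> vec_add K d x y i = x i \<oplus>\<^bsub>K\<^esub> y i"
  by (simp add: vec_add_def)

lemma vec_zero_nth [simp]: "i < d \<Longrightarrow> vec_zero K d i = \<zero>\<^bsub>K\<^esub>"
  by (simp add: vec_zero_def)

lemma finite_vecs: "finite (carrier K) \<Longrightarrow> finite (vecs K d)"
  unfolding vecs_def by (auto intro: finite_PiE)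

lemma card_vecs: "card (vecs K d) = card (carrier K) ^ d"
  unfolding vecs_def by (subst card_PiE) auto

context cring
begin

lemma vec_zero_closed: "vec_zero R d \<in> vecs R d"
  unfolding vec_zero_def by (rule restrict_in_vecs) auto

lemma vec_add_closed: "x \<in> vecs R d \<Longrightarrow> y \<in> vecs R d \<Longrightarrow> vec_add R d x y \<in> vecs R d"
  unfolding vec_add_def by (rule restrict_in_vecs) auto

lemma unit_vec_closed: "unit_vec R d i \<in> vecs R d"
  unfolding unit_vec_def by (rule restrict_in_vecs) auto

lemma module_vec_module: "module R (vec_module R d)"
proof (rule moduleI)
  show "abelian_group (vec_module R d)"
  proof (rule abelian_groupI, goal_cases)
    case (6 x)
    then have "(\<lambda>i\<in>{..<d}. \<ominus> x i) \<in> vecs R d" by (intro restrict_in_vecs) auto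
    with 6 show ?case
      by (intro bexI[of _ "\<lambda>i\<in>{..<d}. \<ominus> x i"])
         (auto simp: l_neg vec_add_closed vec_zero_closed intro!: vecs_ext[of _ R d])
  qed (auto simp: vec_add_closed vec_zero_closed a_ac intro!: vecs_ext[of _ R d])
qed (auto simp: is_cring vec_add_closed restrict_in_vecs l_distr r_distr m_assoc intro!: restrict_in_vecs vecs_ext[of _ R d])

text \<open>The hypotheses are pointwise below \<open>d\<close> instead of membership in
  \<open>vecs\<close>, because rows and columns of coefficient matrices are not extensional.\<close>

lemma dot_closed [simp]:
  "(\<And>i. i < d \<Longrightarrow> x i \<in> carrier R) \<Longrightarrow> (\<And>i. i < d \<Longrightarrow> y i \<in> carrier R) \<Longrightarrow> dot R d x y \<in> carrier R"
  unfolding dot_def by (intro finsum_closed) auto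

lemma dot_cong:
  "(\<And>i. i < d \<Longrightarrow> x i = x' i) \<Longrightarrow> (\<And>i. i < d \<Longrightarrow> y i = y' i) \<Longrightarrow>
   (\<And>i. i < d \<Longrightarrow> x' i \<in> carrier R) \<Longrightarrow> (\<And>i. i < d \<Longrightarrow> y' i \<in> carrier R) \<Longrightarrow>
   dot R d x y = dot R d x' y'"
  unfolding dot_def by (intro finsum_cong') auto

lemma dot_comm:
  "(\<And>i. i < d \<Longrightarrow> x i \<in> carrier R) \<Longrightarrow> (\<And>i. i < d \<Longrightarrow> y i \<in> carrier R) \<Longrightarrow> dot R d x y = dot R d y x"
  unfolding dot_def by (intro finsum_cong') (auto simp: m_comm)

lemma dot_add_right:
  assumes "\<And>i. i < d \<Longrightarrow> x i \<in> carrier R" "y \<in> vecs R d" "z \<in> vecs R d"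
  shows "dot R d x (vec_add R d y z) = dot R d x y \<oplus> dot R d x z"
proof -
  have "dot R d x (vec_add R d y z) = (\<Oplus>i\<in>{..<d}. x i \<otimes> y i \<oplus> x i \<otimes> z i)"
    unfolding dot_def using assms by (intro finsum_cong') (auto simp: r_distr)
  also have "\<dots> = dot R d x y \<oplus> dot R d x z"
    unfolding dot_def using assms by (intro finsum_addf) auto
  finally show ?thesis .
qed

lemma dot_smult_right:
  assumes "\<And>i. i < d \<Longrightarrow> x i \<in> carrier R" "y \<in> vecs R d" "t \<in> carrier R"
  shows "dot R d x (\<lambda>i\<in>{..<d}. t \<otimes> y i) = t \<otimes> dot R d x y"
  unfolding dot_def
  by (subst finsum_rdistr) (use assms in \<open>auto simp: m_ac intro!: finsum_cong'\<close>)

lemma dot_add_left: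
  assumes "x \<in> vecs R d" "y \<in> vecs R d" "z \<in> vecs R d"
  shows "dot R d (vec_add R d x y) z = dot R d x z \<oplus> dot R d y z"
  using assms dot_add_right[of d z x y] by (simp add: dot_comm[of d _ z] vec_add_closed)

lemma dot_smult_left:
  assumes "x \<in> vecs R d" "y \<in> vecs R d" "t \<in> carrier R"
  shows "dot R d (\<lambda>i\<in>{..<d}. t \<otimes> x i) y = t \<otimes> dot R d x y"
  using assms dot_smult_right[of d y x t] by (simp add: dot_comm[of d _ y])

lemma dot_unit_left:
  assumes "y \<in> vecs R d" "i < d"
  shows "dot R d (unit_vec R d i) y = y i"
proof -
  have "dot R d (unit_vec R d i) y = (\<Oplus>j\<in>{..<d}. if i = j then y j else \<zero>)"
    unfolding dot_def unit_vec_def using assms by (intro finsum_cong') auto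
  also have "\<dots> = y i" using assms by (intro finsum_singleton) auto
  finally show ?thesis .
qed

lemma dot_eq_zero:
  assumes "\<And>i. i < d \<Longrightarrow> x i \<otimes> y i = \<zero>"
  shows "dot R d x y = \<zero>"
proof -
  have "dot R d x y = (\<Oplus>i\<in>{..<d}. \<zero>)"
    unfolding dot_def using assms by (intro finsum_cong') auto
  then show ?thesis by (simp add: finsum_zero)
qed

lemma dot_delta:
  assumes "\<And>i. i < d \<Longrightarrow> w i = (if i = k then \<one> else \<zero>)" "k < d" "x \<in> vecs R d"
  shows "dot R d w x = x k"
proof -
  have "dot R d w x = dot R d (unit_vec R d k) x"
    using assms by (intro dot_cong) (auto simp: unit_vec_def)
  then show ?thesis using assms by (simp add: dot_unit_left)
qed

definition mat_vec :: "nat \<Rightarrow> (nat \<Rightarrow> nat \<Rightarrow> 'a) \<Rightarrow> (nat \<Rightarrow> 'a) \<Rightarrow> nat \<Rightarrow> 'a" where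
  "mat_vec d c y = (\<lambda>i\<in>{..<d}. dot R d (c i) y)"

lemma mat_vec_closed:
  "(\<And>i j. i < d \<Longrightarrow> j < d \<Longrightarrow> c i j \<in> carrier R) \<Longrightarrow> y \<in> vecs R d \<Longrightarrow> mat_vec d c y \<in> vecs R d"
  unfolding mat_vec_def by (rule restrict_in_vecs) auto

lemma mat_vec_nth [simp]: "i < d \<Longrightarrow> mat_vec d c y i = dot R d (c i) y"
  by (simp add: mat_vec_def)

lemma mat_vec_add:
  assumes "\<And>i j. i < d \<Longrightarrow> j < d \<Longrightarrow> c i j \<in> carrier R" "x \<in> vecs R d" "y \<in> vecs R d"
  shows "mat_vec d c (vec_add R d x y) = vec_add R d (mat_vec d c x) (mat_vec d c y)"
  using assms by (intro vecs_ext[of _ R d]) (auto simp: vec_add_closed mat_vec_closed dot_add_right)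

lemma mat_vec_smult:
  assumes "\<And>i j. i < d \<Longrightarrow> j < d \<Longrightarrow> c i j \<in> carrier R" "x \<in> vecs R d" "t \<in> carrier R"
  shows "mat_vec d c (\<lambda>i\<in>{..<d}. t \<otimes> x i) = (\<lambda>i\<in>{..<d}. t \<otimes> mat_vec d c x i)"
  using assms by (auto simp: mat_vec_def dot_smult_right)

lemma dot_mat_vec:
  assumes "\<And>i j. i < d \<Longrightarrow> j < d \<Longrightarrow> c i j \<in> carrier R" "x \<in> vecs R d" "y \<in> vecs R d"
  shows "dot R d x (mat_vec d c y) = (\<Oplus>i\<in>{..<d}. \<Oplus>j\<in>{..<d}. c i j \<otimes> x i \<otimes> y j)"
  unfolding dot_def mat_vec_def using assms
  by (intro finsum_cong' refl)
     (auto simp: finsum_rdistr m_ac intro!: finsum_closed finsum_cong')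

lemma dot_mat_vec_transpose:
  assumes "\<And>i j. i < d \<Longrightarrow> j < d \<Longrightarrow> c i j \<in> carrier R" "x \<in> vecs R d" "y \<in> vecs R d"
  shows "dot R d y (mat_vec d c x) = dot R d x (mat_vec d (\<lambda>i j. c j i) y)"
  using assms
  by (subst (1 2) dot_mat_vec, simp_all, subst finsum_swap)
     (auto simp: m_ac intro!: finsum_closed finsum_cong')

text \<open>The coefficients need not be symmetric, so the matrix of the polar form is
  \<open>c\<close> plus its transpose.\<close>

lemma polar_form_eq_dot:
  assumes c: "\<And>i j. i < d \<Longrightarrow> j < d \<Longrightarrow> c i j \<in> carrier R"
    and Q: "\<And>x. x \<in> vecs R d \<Longrightarrow> Q x = (\<Oplus>i\<in>{..<d}. \<Oplus>j\<in>{..<d}. c i j \<otimes> x i \<otimes> x j)"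
    and x: "x \<in> vecs R d" and y: "y \<in> vecs R d"
  shows "Q (vec_add R d x y) = Q x \<oplus> Q y \<oplus> polar_form R d Q x y"
    and "polar_form R d Q x y = dot R d x (vec_add R d (mat_vec d c y) (mat_vec d (\<lambda>i j. c j i) y))"
proof -
  have Qd: "Q x = dot R d x (mat_vec d c x)" if "x \<in> vecs R d" for x
    using that c Q by (simp add: dot_mat_vec)
  have cl: "dot R d x (mat_vec d c y) \<in> carrier R" if "x \<in> vecs R d" "y \<in> vecs R d" for x y
    using that mat_vec_closed[of d c y] c by auto
  have "Q (vec_add R d x y) = dot R d x (mat_vec d c x) \<oplus> dot R d y (mat_vec d c y)
      \<oplus> (dot R d x (mat_vec d c y) \<oplus> dot R d y (mat_vec d c x))"
    using x y c cl
    by (simp add: Qd vec_add_closed mat_vec_add dot_add_left dot_add_right mat_vec_closed a_ac)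
  then have *: "Q (vec_add R d x y) = Q x \<oplus> Q y \<oplus> (dot R d x (mat_vec d c y) \<oplus> dot R d y (mat_vec d c x))"
    using x y by (simp add: Qd)
  moreover have "Q x \<in> carrier R" "Q y \<in> carrier R" using x y cl Qd by auto
  ultimately have p: "polar_form R d Q x y = dot R d x (mat_vec d c y) \<oplus> dot R d y (mat_vec d c x)"
    unfolding polar_form_def using cl x y by (simp only:) algebra
  then show "Q (vec_add R d x y) = Q x \<oplus> Q y \<oplus> polar_form R d Q x y" using * by simp
  show "polar_form R d Q x y = dot R d x (vec_add R d (mat_vec d c y) (mat_vec d (\<lambda>i j. c j i) y))"
    using x y c by (simp add: p dot_add_right mat_vec_closed dot_mat_vec_transpose[of d c x y])
qed

end

section \<open>From the polar form to the dot product\<close>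

context char_field
begin

text \<open>Completing the square involves the polar form, whereas the extension operator involves
  \<open>dot\<close>. The map \<open>L\<close>, given by \<open>c\<close> plus its transpose,
  translates between them; injectivity and \<open>L\<close> of zero are later recovered from the
  pairing identity alone.\<close>

lemma quad_space_vec_module:
  assumes "quadratic_form K d Q"
  shows "quad_space K \<chi> (vec_module K d) Q (polar_form K d Q)"
    and "\<exists>L. \<forall>y\<in>vecs K d. L y \<in> vecs K d \<and> (\<forall>x\<in>vecs K d. polar_form K d Q x y = dot K d x (L y))"
proof -
  obtain c where c: "\<And>i j. i < d \<Longrightarrow> j < d \<Longrightarrow> c i j \<in> carrier K"
    and Q: "\<And>x. x \<in> vecs K d \<Longrightarrow> Q x = (\<Oplus>i\<in>{..<d}. \<Oplus>j\<in>{..<d}. c i j \<otimes> x i \<otimes> x j)"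
    using assms unfolding quadratic_form_def by blast
  note p = polar_form_eq_dot[OF c Q]
  let ?L = "\<lambda>y. vec_add K d (mat_vec d c y) (mat_vec d (\<lambda>i j. c j i) y)"
  have L: "?L y \<in> vecs K d" if "y \<in> vecs K d" for y
    using that c by (intro vec_add_closed mat_vec_closed) auto
  have Qd: "Q x = dot K d x (mat_vec d c x)" if "x \<in> vecs K d" for x
    using that c Q by (simp add: dot_mat_vec)
  have Qcl: "Q x \<in> carrier K" if "x \<in> vecs K d" for x
    using that mat_vec_closed[of d c x] c Qd by auto
  show "quad_space K \<chi> (vec_module K d) Q (polar_form K d Q)"
  proof (intro quad_space.intro quad_space_axioms.intro, goal_cases)
    case 1
    show ?case by (rule char_field_axioms)
  next
    case 2
    show ?case by (rule module_vec_module)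
  next
    case (7 t x)
    then have "(\<lambda>i\<in>{..<d}. t \<otimes> x i) \<in> vecs K d" by (intro restrict_in_vecs) auto
    with 7 c show ?case
      using dot_smult_right[of d x "mat_vec d c x" t] dot_smult_left[of x d "\<lambda>i\<in>{..<d}. t \<otimes> mat_vec d c x i" t]
        mat_vec_closed[of d c x]
      by (simp add: Qd mat_vec_smult m_assoc restrict_in_vecs)
  next
    case (10 x y)
    then have "vec_add K d x y = vec_add K d y x"
      by (auto simp: vec_add_def a_comm intro!: restrict_ext)
    with 10 show ?case using Qcl unfolding polar_form_def
      by (simp add: a_minus_def vec_add_closed a_ac)
  next
    case (9 t x y)
    then have "(\<lambda>i\<in>{..<d}. t \<otimes> x i) \<in> vecs K d" by (intro restrict_in_vecs) auto
    with 9 L show ?case by (simp add: p(2) dot_smult_left)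
  qed (use p L Qcl c in \<open>auto simp: finite_vecs dot_add_left vec_add_closed\<close>)
  show "\<exists>L. \<forall>y\<in>vecs K d. L y \<in> vecs K d \<and> (\<forall>x\<in>vecs K d. polar_form K d Q x y = dot K d x (L y))"
    by (rule exI[of _ ?L]) (use p L in auto)
qed

lemma vec_diff:
  assumes "m \<in> vecs K d" "m' \<in> vecs K d"
  obtains w where "w \<in> vecs K d" "m = vec_add K d w m'" "w = vec_zero K d \<longleftrightarrow> m = m'"
proof -
  interpret M: module K "vec_module K d" by (rule module_vec_module)
  let ?w = "m \<ominus>\<^bsub>vec_module K d\<^esub> m'"
  have w: "?w \<in> vecs K d" using M.minus_closed[of m m'] assms by simp
  have m: "m = vec_add K d ?w m'"
    using assms M.a_assoc[of m "\<ominus>\<^bsub>vec_module K d\<^esub> m'" m'] M.a_inv_closed[of m'] M.l_neg[of m'] M.r_zero[of m]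
    by (simp add: a_minus_def)
  have "?w = vec_zero K d \<longleftrightarrow> m = m'"
  proof
    assume "?w = vec_zero K d"
    then show "m = m'" using m M.l_zero[of m'] assms by simp
  next
    assume "m = m'"
    then show "?w = vec_zero K d" using M.r_neg[of m'] assms by (simp add: a_minus_def)
  qed
  with w m show ?thesis by (rule that)
qed

text \<open>Nondegeneracy makes \<open>L\<close> injective and finiteness makes it onto, so every
  frequency \<open>m\<close> is some \<open>L y\<close>. As \<open>L\<close> fixes the zero vector,
  the main term stays at frequency zero.\<close>

lemma norm_character_sum_variety:
  assumes nd: "nondegenerate_quadratic_form K d Q" and d: "d > 0" and m: "m \<in> vecs K d"
  shows "cmod ((\<Sum>x\<in>variety K d Q. \<chi> (dot K d x m)) - (if m = vec_zero K d then of_nat q ^ (d - 1) else 0))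
    \<le> real q ^ (d div 2)"
proof -
  have qf: "quadratic_form K d Q" using nd by (simp add: nondegenerate_quadratic_form_def)
  interpret quad_space K \<chi> "vec_module K d" Q "polar_form K d Q"
    by (rule quad_space_vec_module(1)[OF qf])
  have ndM: "nondeg (carrier (vec_module K d))"
    using nd by (simp add: nondeg_def nondegenerate_quadratic_form_def)
  obtain L where L: "\<And>y. y \<in> vecs K d \<Longrightarrow> L y \<in> vecs K d"
    and BL: "\<And>x y. x \<in> vecs K d \<Longrightarrow> y \<in> vecs K d \<Longrightarrow> polar_form K d Q x y = dot K d x (L y)"
    using quad_space_vec_module(2)[OF qf] by blast
  have inj: "inj_on L (vecs K d)"
  proof (rule inj_onI)
    fix y z assume yz: "y \<in> vecs K d" "z \<in> vecs K d" "L y = L z"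
    obtain w where w: "w \<in> vecs K d" "y = vec_add K d w z" "w = vec_zero K d \<longleftrightarrow> y = z"
      by (rule vec_diff[OF yz(1,2)])
    have "polar_form K d Q w x = \<zero>" if x: "x \<in> vecs K d" for x
    proof -
      have "polar_form K d Q x y = polar_form K d Q x w \<oplus> polar_form K d Q x z"
        using B_add_right[of w z x] yz w(1,2) x by simp
      then show ?thesis using BL[OF x yz(1)] BL[OF x yz(2)] yz(3) B_sym[of x w] B_closed[of x w] B_closed[of x z] x w(1) yz(1,2)
        by simp
    qed
    then have "w = vec_zero K d" using ndM w(1) unfolding nondeg_def by auto
    then show "y = z" using w(3) by simp
  qed
  then have "L ` vecs K d = vecs K d"
    using L by (intro endo_inj_surj) (auto simp: finite_vecs)
  then obtain y where y: "y \<in> vecs K d" "m = L y" using m by blast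
  have "polar_form K d Q x (vec_zero K d) = \<zero>" if "x \<in> vecs K d" for x
    using B_zero_right[of x] that by simp
  \<comment> \<open>Pairing with unit vectors reads off the coordinates of
    \<open>L (vec_zero K d)\<close>.\<close>
  then have "dot K d (unit_vec K d i) (L (vec_zero K d)) = \<zero>" for i
    using BL[OF unit_vec_closed[of d i], of "vec_zero K d"] vec_zero_closed unit_vec_closed by simp
  then have "L (vec_zero K d) = vec_zero K d"
    using L[OF vec_zero_closed] dot_unit_left[OF L[OF vec_zero_closed]]
    by (intro vecs_ext[of _ K d]) (simp_all add: vec_zero_closed)
  then have m0: "m = vec_zero K d \<longleftrightarrow> y = vec_zero K d"
    using inj y vec_zero_closed by (metis inj_onD)
  have "(\<Sum>x\<in>variety K d Q. \<chi> (dot K d x m)) = (\<Sum>x | x \<in> vecs K d \<and> Q x = \<zero>. \<chi> (polar_form K d Q x y))"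
    unfolding variety_def by (intro sum.cong refl) (auto simp: BL y)
  then show ?thesis
    using norm_character_sum_quadric[OF ndM, of d y] y(1) d by (simp add: m0 card_vecs)
qed

lemma sum_chi_dot:
  assumes m: "m \<in> vecs K d"
  shows "(\<Sum>x\<in>vecs K d. \<chi> (dot K d x m)) = (if m = vec_zero K d then of_nat q ^ d else 0)"
proof (cases "m = vec_zero K d")
  case True
  then have "dot K d x m = \<zero>" if "x \<in> vecs K d" for x
    using that by (intro dot_eq_zero) simp
  then show ?thesis using True by (simp add: card_vecs)
next
  case False
  then obtain i where i: "i < d" "m i \<noteq> \<zero>"
    using m vecs_ext[OF m vec_zero_closed] by (auto simp: vec_zero_def)
  have "(\<Sum>x\<in>carrier (vec_module K d). \<chi> (dot K d x m)) = 0"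
    by (rule sum_chi_linear[where b = "unit_vec K d i"])
       (use m i in \<open>auto simp: module_vec_module finite_vecs dot_add_left dot_smult_left unit_vec_closed dot_unit_left\<close>)
  then show ?thesis using False by simp
qed

end

section \<open>Real interpolation and the adjoint of the extension operator\<close>

text \<open>A sum over dyadic scales is dominated by its largest one: counted downwards from
  \<open>Max I\<close> it is part of a geometric series. The bound does not see how many scales
  occur, which is what avoids the logarithm.\<close>

lemma sum_int_powr_le:
  fixes x s :: real and I :: "int set"
  assumes I: "finite I" "\<And>k. k \<in> I \<Longrightarrow> 2 powr k \<le> x" and s: "s > 0"
  shows "(\<Sum>k\<in>I. (2 powr k) powr s) \<le> x powr s / (1 - 2 powr (- s))"
proof (cases "I = {}")
  case True
  have "2 powr (- s) < (1::real)" using s by (simp add: powr_less_one)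
  then show ?thesis using True by simp
next
  case False
  define m where "m = Max I"
  have m: "m \<in> I" "\<And>k. k \<in> I \<Longrightarrow> k \<le> m" using I False by (auto simp: m_def)
  let ?\<rho> = "2 powr (- s) :: real"
  have \<rho>: "0 < ?\<rho>" "?\<rho> < 1" using s by (auto simp: powr_less_one)
  have inj: "inj_on (\<lambda>k. nat (m - k)) I"
    using m(2) by (auto simp: inj_on_def dest!: m(2))
  have "(\<Sum>k\<in>I. (2 powr k) powr s) = (\<Sum>k\<in>I. (2 powr m) powr s * ?\<rho> ^ nat (m - k))"
  proof (rule sum.cong[OF refl])
    fix k assume "k \<in> I"
    then have "real (nat (m - k)) = m - k" using m(2) by simp
    then show "(2 powr k) powr s = (2 powr m) powr s * ?\<rho> ^ nat (m - k)"
      by (simp add: powr_powr powr_add[symmetric] powr_realpow[symmetric] algebra_simps)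
  qed
  also have "\<dots> = (2 powr m) powr s * (\<Sum>n\<in>(\<lambda>k. nat (m - k)) ` I. ?\<rho> ^ n)"
    by (simp add: sum.reindex[OF inj] sum_distrib_left)
  also have "\<dots> \<le> x powr s * (\<Sum>n. ?\<rho> ^ n)"
    using I m \<rho> s by (intro mult_mono powr_mono2 sum_le_suminf summable_geometric) (auto intro!: sum_nonneg)
  also have "\<dots> = x powr s / (1 - ?\<rho>)"
    using \<rho> by (simp add: suminf_geometric)
  finally show ?thesis .
qed

lemma mult_powr_le_powr_gt:
  fixes x t p :: real
  assumes "t < x" "t > 0" "p > 1"
  shows "x \<le> t powr (1 - p) * x powr p"
proof -
  have "x = x powr (1 - p) * x powr p" using assms by (simp flip: powr_add)
  also have "\<dots> \<le> t powr (1 - p) * x powr p"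
    using assms by (intro mult_right_mono powr_mono2') auto
  finally show ?thesis .
qed

lemma of_real_cmod_power2: "(complex_of_real (cmod z))\<^sup>2 = z * cnj z"
  using complex_norm_square[of z] by simp

text \<open>The leading 1 pays for the large products. In the bracket, \<open>2 powr (2 - p)\<close>
  stems from rounding \<open>cmod (g m)\<close> down to a power of 2, and the fraction from the
  geometric series over the levels; the outer half comes from the inequality between arithmetic and
  geometric mean.\<close>

definition interpolation_const :: "real \<Rightarrow> real" where
  "interpolation_const p = 1 + (2 powr (2 - p) + 1 / (1 - 2 powr (p - 2))) / 2"

lemma interpolation_const_nonneg: "p < 2 \<Longrightarrow> 0 \<le> interpolation_const p"
proof -
  assume "p < 2"
  then have "2 powr (p - 2) < (1::real)" by (simp add: powr_less_one)
  then show ?thesis by (simp add: interpolation_const_def)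
qed

text \<open>
  Real interpolation between \<open>\<ell>\<^sup>1 \<rightarrow> \<ell>\<^sup>\<infinity>\<close> and \<open>\<ell>\<^sup>2 \<rightarrow> \<ell>\<^sup>2\<close> that loses no logarithm: pairs with
  \<open>|g m| |g m'| > t\<close> (up to a factor 2) are estimated by the bound on the kernel, and the
  remaining ones are cut into one product set for every dyadic level of \<open>|g m|\<close>.
\<close>

lemma bilinear_interpolation:
  fixes \<kappa> :: "'v \<Rightarrow> 'v \<Rightarrow> complex" and g :: "'v \<Rightarrow> complex"
  assumes V [simp]: "finite V" and ab: "a > 0" "b > 0" and p: "1 < p" "p < 2"
    and \<kappa>: "\<And>m m'. m \<in> V \<Longrightarrow> m' \<in> V \<Longrightarrow> cmod (\<kappa> m m') \<le> a"
    and L2: "\<And>u v. cmod (\<Sum>m\<in>V. \<Sum>m'\<in>V. u m * cnj (v m') * \<kappa> m m')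
               \<le> b * L2_set (\<lambda>m. cmod (u m)) V * L2_set (\<lambda>m. cmod (v m)) V"
  shows "cmod (\<Sum>m\<in>V. \<Sum>m'\<in>V. g m * cnj (g m') * \<kappa> m m')
    \<le> interpolation_const p * (a powr (2 / p - 1) * b powr (2 - 2 / p) * (\<Sum>m\<in>V. cmod (g m) powr p) powr (2 / p))"
proof -
  define N where "N = (\<Sum>m\<in>V. cmod (g m) powr p)"
  have N0: "N \<ge> 0" unfolding N_def by (intro sum_nonneg) auto
  show ?thesis
  proof (cases "N = 0")
    case True
    then have "\<forall>m\<in>V. cmod (g m) powr p = 0"
      unfolding N_def by (subst (asm) sum_nonneg_eq_0_iff) auto
    then have "(\<Sum>m\<in>V. \<Sum>m'\<in>V. g m * cnj (g m') * \<kappa> m m') = 0" by simp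
    then show ?thesis using p interpolation_const_nonneg[OF p(2)] by simp
  next
    case False
    with N0 have N: "N > 0" by simp
    \<comment> \<open>The solution of
      \<open>a * t powr (1 - p) * N\<^sup>2 = b * sqrt t powr (2 - p) * N\<close>, which balances
      the estimates for large and small products.\<close>
    define t where "t = (a * N / b) powr (2 / p)"
    have t: "t > 0" using ab N by (simp add: t_def)
    define lev where "lev m = \<lfloor>log 2 (cmod (g m))\<rfloor>" for m
    have lev: "2 powr lev m \<le> cmod (g m)" "cmod (g m) < 2 * 2 powr lev m" if "g m \<noteq> 0" for m
      using floor_log_eq_powr_iff[of "cmod (g m)" 2 "lev m"] that by (auto simp: lev_def powr_add)
    define V' where "V' = {m \<in> V. g m \<noteq> 0}"
    \<comment> \<open>With \<open>2 powr lev m\<close> in place of \<open>cmod (g m)\<close> the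
      condition restricts only \<open>m'\<close> once the level is fixed, so each level is a product
      set to which \<open>L2\<close> applies.\<close>
    define low where "low m m' \<longleftrightarrow> cmod (g m') * 2 powr lev m \<le> t" for m m'
    define c where "c m m' = g m * cnj (g m') * \<kappa> m m'" for m m'
    have V' [simp]: "finite V'" by (simp add: V'_def)
    have c_0: "c m m' = 0" if "g m = 0" for m m' using that by (simp add: c_def)
    have split: "(\<Sum>m\<in>V. \<Sum>m'\<in>V. c m m') =
       (\<Sum>m\<in>V'. \<Sum>m'\<in>V. if low m m' then c m m' else 0) + (\<Sum>m\<in>V. \<Sum>m'\<in>V. if low m m' then 0 else c m m')"
    proof -
      have "(\<Sum>m\<in>V'. \<Sum>m'\<in>V. if low m m' then c m m' else 0) = (\<Sum>m\<in>V. \<Sum>m'\<in>V. if low m m' then c m m' else 0)"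
        by (intro sum.mono_neutral_left) (auto simp: V'_def c_0 intro!: sum.neutral split: if_splits)
      then show ?thesis
        by (simp flip: sum.distrib) (intro sum.cong refl, simp)
    qed
    have high: "cmod (\<Sum>m\<in>V. \<Sum>m'\<in>V. if low m m' then 0 else c m m') \<le> a * t powr (1 - p) * N\<^sup>2"
    proof -
      have "cmod (\<Sum>m\<in>V. \<Sum>m'\<in>V. if low m m' then 0 else c m m')
         \<le> (\<Sum>m\<in>V. \<Sum>m'\<in>V. a * t powr (1 - p) * (cmod (g m) powr p * cmod (g m') powr p))"
      proof (intro sum_norm_le)
        fix m m' assume m: "m \<in> V" "m' \<in> V"
        show "cmod (if low m m' then 0 else c m m') \<le> a * t powr (1 - p) * (cmod (g m) powr p * cmod (g m') powr p)"
        proof (cases "low m m' \<or> g m = 0 \<or> g m' = 0")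
          case True
          then show ?thesis using ab t by (auto simp: c_def)
        next
          case False
          let ?x = "cmod (g m) * cmod (g m')"
          have "t < cmod (g m') * 2 powr lev m" using False by (simp add: low_def)
          also have "\<dots> \<le> ?x" using lev[of m] False by (simp add: mult.commute mult_left_mono)
          finally have x: "t < ?x" .
          have "cmod (c m m') = ?x * cmod (\<kappa> m m')" by (simp add: c_def norm_mult)
          also have "\<dots> \<le> (t powr (1 - p) * ?x powr p) * a"
            using mult_powr_le_powr_gt[OF x t p(1)] \<kappa>[OF m] by (rule mult_mono) auto
          finally show ?thesis using False by (simp add: powr_mult mult_ac)
        qed
      qed
      also have "\<dots> = a * t powr (1 - p) * N\<^sup>2"
        unfolding N_def power2_eq_square sum_product by (simp only: sum_distrib_left)
      finally show ?thesis .
    qed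
    define I where "I = lev ` V'"
    \<comment> \<open>Weight for the mean inequality at level \<open>k\<close>: there
      \<open>g m\<close> has size about \<open>2 powr k\<close> while its partner is cut at
      \<open>t / 2 powr k\<close>, and the two agree at \<open>sqrt t\<close>. The exponent
      \<open>2 - p\<close> turns the squares in both resulting sums into \<open>p\<close>-th
      powers.\<close>
    define \<omega> where "\<omega> k = (sqrt t / 2 powr k) powr (2 - p)" for k :: int
    define u where "u k m = (if m \<in> V' \<and> lev m = k then g m else 0)" for k m
    define v where "v k m = (if cmod (g m) * 2 powr k \<le> t then g m else 0)" for k :: int and m
    have \<omega>: "\<omega> k > 0" for k using t by (simp add: \<omega>_def)
    have "cmod (\<Sum>m\<in>V'. \<Sum>m'\<in>V. if low m m' then c m m' else 0)
      = cmod (\<Sum>k\<in>I. \<Sum>m\<in>V. \<Sum>m'\<in>V. u k m * cnj (v k m') * \<kappa> m m')"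
    proof -
      have "(\<Sum>m\<in>V'. \<Sum>m'\<in>V. if low m m' then c m m' else 0)
        = (\<Sum>k\<in>I. \<Sum>m\<in>{m \<in> V'. lev m = k}. \<Sum>m'\<in>V. if low m m' then c m m' else 0)"
        unfolding I_def by (rule sum.group[symmetric]) auto
      also have "\<dots> = (\<Sum>k\<in>I. \<Sum>m\<in>V. \<Sum>m'\<in>V. u k m * cnj (v k m') * \<kappa> m m')"
        by (intro sum.cong[OF refl] sum.mono_neutral_cong_left)
           (auto simp: V'_def u_def v_def low_def c_def intro!: sum.neutral sum.cong)
      finally show ?thesis by simp
    qed
    also have "\<dots> \<le> (\<Sum>k\<in>I. b * L2_set (\<lambda>m. cmod (u k m)) V * L2_set (\<lambda>m. cmod (v k m)) V)"
      by (intro sum_norm_le L2)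
    also have "\<dots> \<le> (\<Sum>k\<in>I. b / 2 * (\<omega> k * (\<Sum>m\<in>V. (cmod (u k m))\<^sup>2) + (\<Sum>m\<in>V. (cmod (v k m))\<^sup>2) / \<omega> k))"
    proof (rule sum_mono)
      fix k assume "k \<in> I"
      let ?U = "L2_set (\<lambda>m. cmod (u k m)) V" and ?W = "L2_set (\<lambda>m. cmod (v k m)) V"
      have sq: "(\<Sum>m\<in>V. (cmod (u k m))\<^sup>2) = ?U\<^sup>2" "(\<Sum>m\<in>V. (cmod (v k m))\<^sup>2) = ?W\<^sup>2"
        by (simp_all add: L2_set_def sum_nonneg)
      have "0 \<le> (sqrt (\<omega> k) * ?U - ?W / sqrt (\<omega> k))\<^sup>2" by simp
      also have "\<dots> = \<omega> k * ?U\<^sup>2 + ?W\<^sup>2 / \<omega> k - 2 * (?U * ?W)"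
        using \<omega>[of k] by (simp add: power2_diff power_mult_distrib power_divide)
      finally have "b * (2 * (?U * ?W)) \<le> b * (\<omega> k * ?U\<^sup>2 + ?W\<^sup>2 / \<omega> k)"
        using ab by (intro mult_left_mono) auto
      then show "b * ?U * ?W \<le> b / 2 * (\<omega> k * (\<Sum>m\<in>V. (cmod (u k m))\<^sup>2) + (\<Sum>m\<in>V. (cmod (v k m))\<^sup>2) / \<omega> k)"
        unfolding sq by simp
    qed
    also have "\<dots> = b / 2 * ((\<Sum>k\<in>I. \<omega> k * (\<Sum>m\<in>V. (cmod (u k m))\<^sup>2)) + (\<Sum>k\<in>I. (\<Sum>m\<in>V. (cmod (v k m))\<^sup>2) / \<omega> k))"
      by (simp only: sum_distrib_left[symmetric] sum.distrib)
    also have "\<dots> \<le> b / 2 * (sqrt t powr (2 - p) * 2 powr (2 - p) * N + sqrt t powr (2 - p) * (1 / (1 - 2 powr (p - 2))) * N)"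
    proof (intro mult_left_mono add_mono)
      have "(\<Sum>k\<in>I. \<omega> k * (\<Sum>m\<in>V. (cmod (u k m))\<^sup>2)) = (\<Sum>k\<in>I. \<Sum>m\<in>{m \<in> V'. lev m = k}. \<omega> (lev m) * (cmod (g m))\<^sup>2)"
        unfolding sum_distrib_left
        by (intro sum.cong[OF refl] sum.mono_neutral_cong_right) (auto simp: V'_def u_def)
      also have "\<dots> = (\<Sum>m\<in>V'. \<omega> (lev m) * (cmod (g m))\<^sup>2)"
        unfolding I_def by (rule sum.group) auto
      also have "\<dots> \<le> (\<Sum>m\<in>V'. sqrt t powr (2 - p) * 2 powr (2 - p) * cmod (g m) powr p)"
      proof (rule sum_mono)
        fix m assume "m \<in> V'"
        then have m: "g m \<noteq> 0" by (simp add: V'_def)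
        have "(cmod (g m))\<^sup>2 = cmod (g m) powr (2 - p) * cmod (g m) powr p"
          using m by (simp flip: powr_add)
        also have "\<dots> \<le> (2 * 2 powr lev m) powr (2 - p) * cmod (g m) powr p"
          using lev[OF m] p by (intro mult_right_mono powr_mono2) auto
        finally have "\<omega> (lev m) * (cmod (g m))\<^sup>2 \<le> \<omega> (lev m) * ((2 * 2 powr lev m) powr (2 - p) * cmod (g m) powr p)"
          using \<omega>[of "lev m"] by (intro mult_left_mono) auto
        also have "\<dots> = (sqrt t / 2 powr lev m * (2 * 2 powr lev m)) powr (2 - p) * cmod (g m) powr p"
          unfolding \<omega>_def by (simp only: powr_mult mult.assoc)
        also have "sqrt t / 2 powr lev m * (2 * 2 powr lev m) = sqrt t * 2" by simp
        finally show "\<omega> (lev m) * (cmod (g m))\<^sup>2 \<le> sqrt t powr (2 - p) * 2 powr (2 - p) * cmod (g m) powr p"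
          by (simp only: powr_mult)
      qed
      also have "\<dots> \<le> (\<Sum>m\<in>V. sqrt t powr (2 - p) * 2 powr (2 - p) * cmod (g m) powr p)"
        by (intro sum_mono2) (auto simp: V'_def)
      finally show "(\<Sum>k\<in>I. \<omega> k * (\<Sum>m\<in>V. (cmod (u k m))\<^sup>2)) \<le> sqrt t powr (2 - p) * 2 powr (2 - p) * N"
        by (simp add: N_def sum_distrib_left)
    next
      have "(\<Sum>k\<in>I. (\<Sum>m\<in>V. (cmod (v k m))\<^sup>2) / \<omega> k) = (\<Sum>m\<in>V. \<Sum>k\<in>I. (cmod (v k m))\<^sup>2 / \<omega> k)"
        by (subst sum.swap) (simp add: sum_divide_distrib)
      also have "\<dots> \<le> (\<Sum>m\<in>V. sqrt t powr (2 - p) * (1 / (1 - 2 powr (p - 2))) * cmod (g m) powr p)"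
      proof (rule sum_mono)
        fix m assume "m \<in> V"
        show "(\<Sum>k\<in>I. (cmod (v k m))\<^sup>2 / \<omega> k) \<le> sqrt t powr (2 - p) * (1 / (1 - 2 powr (p - 2))) * cmod (g m) powr p"
        proof (cases "g m = 0")
          case False
          \<comment> \<open>Exactly the levels at which \<open>v k m\<close> survives; the largest
            of them dominates the sum.\<close>
          let ?J = "{k \<in> I. 2 powr k \<le> t / cmod (g m)}"
          have "(\<Sum>k\<in>I. (cmod (v k m))\<^sup>2 / \<omega> k) = (\<Sum>k\<in>?J. (cmod (g m))\<^sup>2 / sqrt t powr (2 - p) * (2 powr k) powr (2 - p))"
            using False t
            by (intro sum.mono_neutral_cong_right) (auto simp: I_def v_def \<omega>_def powr_divide field_simps)
          also have "\<dots> = (cmod (g m))\<^sup>2 / sqrt t powr (2 - p) * (\<Sum>k\<in>?J. (2 powr k) powr (2 - p))"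
            by (simp only: sum_distrib_left)
          also have "\<dots> \<le> (cmod (g m))\<^sup>2 / sqrt t powr (2 - p) * ((t / cmod (g m)) powr (2 - p) / (1 - 2 powr (- (2 - p))))"
            using p t by (intro mult_left_mono sum_int_powr_le) (auto simp: I_def)
          also have "(t / cmod (g m)) powr (2 - p) = sqrt t powr (2 - p) * sqrt t powr (2 - p) / cmod (g m) powr (2 - p)"
            using t by (simp add: powr_divide flip: powr_mult)
          also have "(cmod (g m))\<^sup>2 / sqrt t powr (2 - p)
              * (sqrt t powr (2 - p) * sqrt t powr (2 - p) / cmod (g m) powr (2 - p) / (1 - 2 powr (- (2 - p))))
            = sqrt t powr (2 - p) * (1 / (1 - 2 powr (p - 2))) * ((cmod (g m))\<^sup>2 / cmod (g m) powr (2 - p))"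
            using t by (simp add: mult_ac)
          also have "(cmod (g m))\<^sup>2 / cmod (g m) powr (2 - p) = cmod (g m) powr p"
            using False powr_diff[of "cmod (g m)" 2 "2 - p"] by simp
          finally show ?thesis .
        qed (simp add: v_def)
      qed
      finally show "(\<Sum>k\<in>I. (\<Sum>m\<in>V. (cmod (v k m))\<^sup>2) / \<omega> k) \<le> sqrt t powr (2 - p) * (1 / (1 - 2 powr (p - 2))) * N"
        by (simp add: N_def sum_distrib_left)
    qed (use ab in auto)
    also have "\<dots> = (interpolation_const p - 1) * (b * sqrt t powr (2 - p) * N)"
    proof -
      have "b / 2 * (x * y * N + x * z * N) = (1 + (y + z) / 2 - 1) * (b * x * N)" for x y z
        by (simp add: algebra_simps)
      then show ?thesis unfolding interpolation_const_def .
    qed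
    finally have low: "cmod (\<Sum>m\<in>V'. \<Sum>m'\<in>V. if low m m' then c m m' else 0)
      \<le> (interpolation_const p - 1) * (b * sqrt t powr (2 - p) * N)" .
    let ?R = "a powr (2 / p - 1) * b powr (2 - 2 / p) * N powr (2 / p)"
    \<comment> \<open>In logarithms, the agreement of both bounds with the claimed one is an
      identity between linear forms.\<close>
    define \<alpha> \<beta> \<nu> where "\<alpha> = ln a" "\<beta> = ln b" "\<nu> = ln N"
    then have exps: "a = exp \<alpha>" "b = exp \<beta>" "N = exp \<nu>" using ab N by auto
    have t_exp: "t = exp (2 / p * (\<alpha> + \<nu> - \<beta>))" "sqrt t = exp (1 / p * (\<alpha> + \<nu> - \<beta>))"
    proof -
      show 1: "t = exp (2 / p * (\<alpha> + \<nu> - \<beta>))"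
        unfolding t_def exps by (simp flip: exp_add exp_diff add: powr_def)
      have "t = (exp (1 / p * (\<alpha> + \<nu> - \<beta>)))\<^sup>2"
        unfolding 1 by (simp flip: exp_of_nat_mult add: exp_double[symmetric])
      then show "sqrt t = exp (1 / p * (\<alpha> + \<nu> - \<beta>))" by simp
    qed
    have R_exp: "?R = exp ((2 / p - 1) * \<alpha> + (2 - 2 / p) * \<beta> + 2 / p * \<nu>)"
      unfolding exps by (simp add: powr_def exp_add)
    have "a * t powr (1 - p) * N\<^sup>2 = exp (\<alpha> + (1 - p) * (2 / p * (\<alpha> + \<nu> - \<beta>)) + 2 * \<nu>)"
      unfolding t_exp(1) exps by (simp add: powr_def exp_add power2_eq_square exp_double)
    also have "\<alpha> + (1 - p) * (2 / p * (\<alpha> + \<nu> - \<beta>)) + 2 * \<nu> = (2 / p - 1) * \<alpha> + (2 - 2 / p) * \<beta> + 2 / p * \<nu>"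
      using p by (simp add: field_simps)
    finally have high': "a * t powr (1 - p) * N\<^sup>2 = ?R" unfolding R_exp .
    have "b * sqrt t powr (2 - p) * N = exp (\<beta> + (2 - p) * (1 / p * (\<alpha> + \<nu> - \<beta>)) + \<nu>)"
      unfolding t_exp(2) unfolding exps by (simp add: powr_def exp_add)
    also have "\<beta> + (2 - p) * (1 / p * (\<alpha> + \<nu> - \<beta>)) + \<nu> = (2 / p - 1) * \<alpha> + (2 - 2 / p) * \<beta> + 2 / p * \<nu>"
      using p by (simp add: field_simps)
    finally have low': "b * sqrt t powr (2 - p) * N = ?R" unfolding R_exp .
    have "cmod (\<Sum>m\<in>V. \<Sum>m'\<in>V. c m m') \<le> (interpolation_const p - 1) * ?R + ?R"
      unfolding split using low high unfolding high' low' by (intro order_trans[OF norm_triangle_ineq] add_mono)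
    also have "\<dots> = interpolation_const p * ?R" by (simp add: algebra_simps)
    finally show ?thesis unfolding c_def N_def .
  qed
qed

text \<open>The embedding of l^p into l^2: every single value is at most the l^p norm, so a power
  \<open>2 - p\<close> of it can be replaced by that norm.\<close>

lemma sum_square_le_powr:
  assumes V: "finite V" and p: "1 < p" "p < 2"
  shows "(\<Sum>m\<in>V. (cmod (g m))\<^sup>2) \<le> (\<Sum>m\<in>V. cmod (g m) powr p) powr (2 / p)"
proof -
  define N where "N = (\<Sum>m\<in>V. cmod (g m) powr p)"
  have N0: "N \<ge> 0" unfolding N_def by (intro sum_nonneg) auto
  have "(\<Sum>m\<in>V. (cmod (g m))\<^sup>2) \<le> (\<Sum>m\<in>V. cmod (g m) powr p * N powr (2 / p - 1))"
  proof (rule sum_mono)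
    fix m assume m: "m \<in> V"
    show "(cmod (g m))\<^sup>2 \<le> cmod (g m) powr p * N powr (2 / p - 1)"
    proof (cases "g m = 0")
      case False
      have "cmod (g m) powr p \<le> N" unfolding N_def using V m by (intro member_le_sum) auto
      then have "(cmod (g m) powr p) powr (2 / p - 1) \<le> N powr (2 / p - 1)"
        using p by (intro powr_mono2) (auto simp: field_simps)
      then have "cmod (g m) powr p * (cmod (g m) powr p) powr (2 / p - 1) \<le> cmod (g m) powr p * N powr (2 / p - 1)"
        by (intro mult_left_mono) auto
      moreover have "cmod (g m) powr p * (cmod (g m) powr p) powr (2 / p - 1) = (cmod (g m))\<^sup>2"
        using False p by (simp add: powr_powr field_simps flip: powr_add)
      ultimately show ?thesis by simp
    qed simp
  qed
  also have "\<dots> = N * N powr (2 / p - 1)" by (simp add: N_def sum_distrib_right)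
  also have "\<dots> = N powr (2 / p)" using N0 by (cases "N = 0") (auto simp: powr_mult_base)
  finally show ?thesis unfolding N_def .
qed

text \<open>The test function \<open>g = |u|\<^sup>r\<^sup>-\<^sup>2 cnj u\<close> for \<open>u\<close> the extension of \<open>f\<close> turns the bound on the
  adjoint operator into a bound on the extension operator.\<close>

lemma extension_bound_of_adjoint_bound:
  fixes e :: "'x \<Rightarrow> 'v \<Rightarrow> complex"
  assumes S: "finite S" "S \<noteq> {}" and V: "finite V" and p: "1 < p" and A: "A \<ge> 0"
    and adj: "\<And>g. (\<Sum>x\<in>S. (cmod (\<Sum>m\<in>V. g m * e x m))\<^sup>2) / card S \<le> A * (\<Sum>m\<in>V. cmod (g m) powr p) powr (2 / p)"
  defines "r \<equiv> p / (p - 1)"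
  shows "(\<Sum>m\<in>V. cmod (1 / of_nat (card S) * (\<Sum>x\<in>S. e x m * f x)) powr r) powr (1 / r)
    \<le> sqrt A * sqrt ((\<Sum>x\<in>S. (cmod (f x))\<^sup>2) / card S)"
proof -
  define u where "u m = 1 / of_nat (card S) * (\<Sum>x\<in>S. e x m * f x)" for m
  define g where "g m = (if u m = 0 then 0 else cnj (u m) * cmod (u m) powr (r - 2))" for m
  define N where "N = (\<Sum>m\<in>V. cmod (u m) powr r)"
  have N0: "N \<ge> 0" unfolding N_def by (intro sum_nonneg) auto
  have n: "real (card S) > 0" using S by (simp add: card_gt_0_iff)
  \<comment> \<open>\<open>r\<close> is dual to \<open>p\<close>; the second identity gives
    \<open>cmod (g m) powr p = cmod (u m) powr r\<close>.\<close>
  have r: "r > 1" "p * (r - 1) = r" "2 - 2 / p = 2 / r" using p by (auto simp: r_def field_simps)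
  have norm_g: "cmod (g m) = cmod (u m) powr (r - 1)" for m
    by (auto simp: g_def norm_mult powr_mult_base)
  have gp: "(\<Sum>m\<in>V. cmod (g m) powr p) = N"
    unfolding N_def norm_g powr_powr using r by (simp add: mult.commute)
  have ug: "g m * u m = of_real (cmod (u m) powr r)" for m
  proof (cases "u m = 0")
    case False
    have "g m * u m = of_real (cmod (u m) powr (r - 2)) * of_real ((cmod (u m))\<^sup>2)"
      using False by (simp add: g_def of_real_cmod_power2 mult_ac)
    also have "\<dots> = of_real (cmod (u m) powr (r - 2) * cmod (u m) powr 2)"
      by simp
    also have "cmod (u m) powr (r - 2) * cmod (u m) powr 2 = cmod (u m) powr r"
      by (simp only: powr_add[symmetric] diff_add_cancel)
    finally show ?thesis .
  qed simp
  let ?F = "(\<Sum>x\<in>S. (cmod (f x))\<^sup>2) / card S"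
  let ?h = "\<lambda>x. \<Sum>m\<in>V. g m * e x m"
  have "complex_of_real N = (\<Sum>m\<in>V. g m * u m)" by (simp add: N_def ug)
  also have "\<dots> = 1 / of_nat (card S) * (\<Sum>x\<in>S. f x * ?h x)"
    unfolding u_def sum_distrib_left by (subst sum.swap) (simp add: mult_ac)
  finally have "N = cmod (1 / of_nat (card S) * (\<Sum>x\<in>S. f x * ?h x))"
    using N0 by (metis abs_of_nonneg norm_of_real)
  also have "\<dots> \<le> 1 / card S * (\<Sum>x\<in>S. \<bar>cmod (f x)\<bar> * \<bar>cmod (?h x)\<bar>)"
    unfolding norm_mult by (intro mult_mono sum_norm_le) (auto simp: norm_mult norm_divide)
  also have "\<dots> \<le> 1 / card S * (L2_set (\<lambda>x. cmod (f x)) S * L2_set (\<lambda>x. cmod (?h x)) S)"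
    by (intro mult_left_mono L2_set_mult_ineq) auto
  also have "\<dots> = sqrt ?F * sqrt ((\<Sum>x\<in>S. (cmod (?h x))\<^sup>2) / card S)"
    using n by (simp add: L2_set_def real_sqrt_divide)
  also have "\<dots> \<le> sqrt ?F * sqrt (A * N powr (2 / p))"
    using adj[of g] gp by (intro mult_left_mono) (auto intro!: divide_nonneg_nonneg sum_nonneg)
  also have "sqrt (A * N powr (2 / p)) = sqrt A * N powr (1 / p)"
    by (simp add: real_sqrt_mult powr_half_sqrt[symmetric] powr_powr)
  finally have le: "N \<le> sqrt A * sqrt ?F * N powr (1 / p)" by (simp add: mult_ac)
  show ?thesis
  proof (cases "N = 0")
    case True
    have "0 \<le> ?F" by (intro divide_nonneg_nonneg sum_nonneg) auto
    with True A show ?thesis unfolding N_def u_def by simp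
  next
    case False
    with N0 have N: "N > 0" by simp
    have "1 / r = 1 - 1 / p" using p by (simp add: r_def field_simps)
    then have "N powr (1 / r) * N powr (1 / p) = N" using N by (simp flip: powr_add)
    with le have "N powr (1 / r) * N powr (1 / p) \<le> sqrt A * sqrt ?F * N powr (1 / p)" by simp
    then have "N powr (1 / r) \<le> sqrt A * sqrt ?F" using N by simp
    then show ?thesis unfolding N_def u_def .
  qed
qed

text \<open>Stein-Tomas for an abstract orthogonal system: the squared norm of the adjoint is a form
  whose kernel is the normalised transform of \<open>S\<close>. Its diagonal gives the summand 1
  through \<open>sum_square_le_powr\<close>, and the remaining kernel is interpolated.\<close>

lemma extension_estimate:
  fixes e :: "'x \<Rightarrow> 'v \<Rightarrow> complex" and a :: real
  assumes X: "finite X" and S: "S \<subseteq> X" "S \<noteq> {}" and V: "finite V" and p: "1 < p" "p < 2" and a: "a > 0"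
    and unim: "\<And>x m. x \<in> S \<Longrightarrow> m \<in> V \<Longrightarrow> cmod (e x m) = 1"
    and orth: "\<And>m m'. m \<in> V \<Longrightarrow> m' \<in> V \<Longrightarrow> (\<Sum>x\<in>X. e x m * cnj (e x m')) = (if m = m' then of_nat (card X) else 0)"
    and decay: "\<And>m m'. m \<in> V \<Longrightarrow> m' \<in> V \<Longrightarrow> m \<noteq> m' \<Longrightarrow> cmod (\<Sum>x\<in>S. e x m * cnj (e x m')) \<le> a * card S"
  defines "r \<equiv> p / (p - 1)"
  shows "(\<Sum>m\<in>V. cmod (1 / of_nat (card S) * (\<Sum>x\<in>S. e x m * f x)) powr r) powr (1 / r)
    \<le> sqrt (1 + interpolation_const p * (a powr (2 / p - 1) * (card X / card S + 1) powr (2 - 2 / p)))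
       * sqrt ((\<Sum>x\<in>S. (cmod (f x))\<^sup>2) / card S)"
  unfolding r_def
proof (rule extension_bound_of_adjoint_bound)
  show fin: "finite S" using X S finite_subset by blast
  have n: "real (card S) > 0" using S fin by (simp add: card_gt_0_iff)
  \<comment> \<open>Plancherel on all of \<open>X\<close> gives \<open>card X / card S\<close>; the
    1 is the price of subtracting the identity.\<close>
  define b where "b = real (card X) / card S + 1"
  have b: "b > 0" unfolding b_def by (intro add_nonneg_pos) auto
  \<comment> \<open>Zero on the diagonal, so that \<open>decay\<close> bounds the kernel
    everywhere.\<close>
  define \<kappa> where "\<kappa> m m' = (\<Sum>x\<in>S. e x m * cnj (e x m')) / of_nat (card S) - (if m = m' then 1 else 0)" for m m'
  have norm_\<kappa>: "cmod (\<kappa> m m') \<le> a" if "m \<in> V" "m' \<in> V" for m m'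
  proof (cases "m = m'")
    case True
    have "(\<Sum>x\<in>S. e x m * cnj (e x m)) = of_nat (card S)"
      using unim that by (simp flip: complex_norm_square)
    then show ?thesis using True n a by (simp add: \<kappa>_def)
  next
    case False
    then show ?thesis using decay[OF that False] n by (simp add: \<kappa>_def norm_divide field_simps)
  qed
  have form: "(\<Sum>m\<in>V. \<Sum>m'\<in>V. u m * cnj (v m') * \<kappa> m m') =
      (\<Sum>x\<in>S. (\<Sum>m\<in>V. u m * e x m) * cnj (\<Sum>m\<in>V. v m * e x m)) / of_nat (card S) - (\<Sum>m\<in>V. u m * cnj (v m))" for u v
  proof -
    have "(\<Sum>x\<in>S. (\<Sum>m\<in>V. u m * e x m) * cnj (\<Sum>m\<in>V. v m * e x m))
      = (\<Sum>m\<in>V. \<Sum>m'\<in>V. \<Sum>x\<in>S. u m * cnj (v m') * (e x m * cnj (e x m')))"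
      by (simp add: sum_product sum.swap[of _ S V] mult_ac)
    then have *: "(\<Sum>x\<in>S. (\<Sum>m\<in>V. u m * e x m) * cnj (\<Sum>m\<in>V. v m * e x m)) / of_nat (card S)
      = (\<Sum>m\<in>V. \<Sum>m'\<in>V. u m * cnj (v m') * ((\<Sum>x\<in>S. e x m * cnj (e x m')) / of_nat (card S)))"
      by (simp add: sum_distrib_left sum_divide_distrib)
    have "(\<Sum>m\<in>V. u m * cnj (v m)) = (\<Sum>m\<in>V. \<Sum>m'\<in>V. u m * cnj (v m') * (if m = m' then 1 else 0))"
      using V by (simp add: if_distrib cong: if_cong)
    then show ?thesis unfolding * \<kappa>_def by (simp add: sum_subtractf algebra_simps)
  qed
  have plancherel: "L2_set (\<lambda>x. cmod (\<Sum>m\<in>V. u m * e x m)) S \<le> sqrt (card X) * L2_set (\<lambda>m. cmod (u m)) V" for u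
  proof -
    have "(\<Sum>x\<in>X. (\<Sum>m\<in>V. u m * e x m) * cnj (\<Sum>m\<in>V. u m * e x m))
      = (\<Sum>m\<in>V. \<Sum>m'\<in>V. \<Sum>x\<in>X. u m * cnj (u m') * (e x m * cnj (e x m')))"
      by (simp add: sum_product sum.swap[of _ X V] mult_ac)
    also have "\<dots> = (\<Sum>m\<in>V. \<Sum>m'\<in>V. u m * cnj (u m') * (if m = m' then of_nat (card X) else 0))"
      by (intro sum.cong refl) (simp add: orth flip: sum_distrib_left)
    also have "\<dots> = of_real (card X * (\<Sum>m\<in>V. (cmod (u m))\<^sup>2))"
      using V by (simp add: if_distrib sum_distrib_left mult_ac of_real_cmod_power2 cong: if_cong)
    finally have "complex_of_real (\<Sum>x\<in>X. (cmod (\<Sum>m\<in>V. u m * e x m))\<^sup>2) = of_real (card X * (\<Sum>m\<in>V. (cmod (u m))\<^sup>2))"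
      by (simp only: of_real_sum complex_norm_square)
    then have "(\<Sum>x\<in>X. (cmod (\<Sum>m\<in>V. u m * e x m))\<^sup>2) = card X * (\<Sum>m\<in>V. (cmod (u m))\<^sup>2)"
      by (simp only: of_real_eq_iff)
    moreover have "(\<Sum>x\<in>S. (cmod (\<Sum>m\<in>V. u m * e x m))\<^sup>2) \<le> (\<Sum>x\<in>X. (cmod (\<Sum>m\<in>V. u m * e x m))\<^sup>2)"
      using X S by (intro sum_mono2) auto
    ultimately show ?thesis
      unfolding L2_set_def real_sqrt_mult[symmetric] by simp
  qed
  have L2: "cmod (\<Sum>m\<in>V. \<Sum>m'\<in>V. u m * cnj (v m') * \<kappa> m m')
     \<le> b * L2_set (\<lambda>m. cmod (u m)) V * L2_set (\<lambda>m. cmod (v m)) V" for u v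
  proof -
    let ?u = "L2_set (\<lambda>m. cmod (u m)) V" and ?v = "L2_set (\<lambda>m. cmod (v m)) V"
    let ?U = "\<lambda>x. \<Sum>m\<in>V. u m * e x m" and ?W = "\<lambda>x. \<Sum>m\<in>V. v m * e x m"
    have "cmod (\<Sum>x\<in>S. ?U x * cnj (?W x)) \<le> (\<Sum>x\<in>S. \<bar>cmod (?U x)\<bar> * \<bar>cmod (?W x)\<bar>)"
      by (intro sum_norm_le) (simp only: norm_mult complex_mod_cnj abs_norm_cancel order_refl)
    also have "\<dots> \<le> L2_set (\<lambda>x. cmod (?U x)) S * L2_set (\<lambda>x. cmod (?W x)) S"
      by (rule L2_set_mult_ineq)
    also have "\<dots> \<le> (sqrt (card X) * ?u) * (sqrt (card X) * ?v)"
      by (intro mult_mono plancherel) (auto simp: L2_set_nonneg)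
    also have "\<dots> = (sqrt (card X) * sqrt (card X)) * (?u * ?v)" by (simp only: mult_ac)
    also have "sqrt (card X) * sqrt (card X) = card X" by simp
    finally have 1: "cmod (\<Sum>x\<in>S. ?U x * cnj (?W x)) \<le> card X * (?u * ?v)" .
    have "cmod (\<Sum>m\<in>V. u m * cnj (v m)) \<le> (\<Sum>m\<in>V. \<bar>cmod (u m)\<bar> * \<bar>cmod (v m)\<bar>)"
      by (intro sum_norm_le) (simp add: norm_mult)
    also have "\<dots> \<le> ?u * ?v" by (rule L2_set_mult_ineq)
    finally have 2: "cmod (\<Sum>m\<in>V. u m * cnj (v m)) \<le> ?u * ?v" .
    have "cmod (\<Sum>m\<in>V. \<Sum>m'\<in>V. u m * cnj (v m') * \<kappa> m m')
      \<le> cmod (\<Sum>x\<in>S. ?U x * cnj (?W x)) / card S + cmod (\<Sum>m\<in>V. u m * cnj (v m))"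
      unfolding form by (rule order_trans[OF norm_triangle_ineq4]) (simp add: norm_divide)
    also have "\<dots> \<le> card X * (?u * ?v) / card S + ?u * ?v"
      using 1 2 n by (intro add_mono divide_right_mono) auto
    finally show ?thesis by (simp add: b_def algebra_simps)
  qed
  show "(\<Sum>x\<in>S. (cmod (\<Sum>m\<in>V. g m * e x m))\<^sup>2) / card S
    \<le> (1 + interpolation_const p * (a powr (2 / p - 1) * (card X / card S + 1) powr (2 - 2 / p)))
      * (\<Sum>m\<in>V. cmod (g m) powr p) powr (2 / p)" for g
  proof -
    let ?N = "(\<Sum>m\<in>V. cmod (g m) powr p) powr (2 / p)"
    have "complex_of_real ((\<Sum>x\<in>S. (cmod (\<Sum>m\<in>V. g m * e x m))\<^sup>2) / card S)
      = (\<Sum>m\<in>V. \<Sum>m'\<in>V. g m * cnj (g m') * \<kappa> m m') + of_real (\<Sum>m\<in>V. (cmod (g m))\<^sup>2)"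
      unfolding form by (simp add: of_real_cmod_power2)
    then have "(\<Sum>x\<in>S. (cmod (\<Sum>m\<in>V. g m * e x m))\<^sup>2) / card S
      \<le> cmod (\<Sum>m\<in>V. \<Sum>m'\<in>V. g m * cnj (g m') * \<kappa> m m') + (\<Sum>m\<in>V. (cmod (g m))\<^sup>2)"
    proof -
      have "x \<le> cmod z + y" if "complex_of_real x = z + of_real y" "0 \<le> y" for x y z
        using norm_triangle_ineq[of z "of_real y"] that(2) abs_ge_self[of x] by (simp flip: that(1))
      from this[OF \<open>complex_of_real _ = _\<close>] show ?thesis by (simp add: sum_nonneg)
    qed
    also have "\<dots> \<le> interpolation_const p * (a powr (2 / p - 1) * b powr (2 - 2 / p) * ?N) + ?N"
      by (intro add_mono bilinear_interpolation sum_square_le_powr) (use V a b p norm_\<kappa> L2 in auto)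
    finally show ?thesis unfolding b_def by (simp add: algebra_simps)
  qed
  show "0 \<le> 1 + interpolation_const p * (a powr (2 / p - 1) * (card X / card S + 1) powr (2 - 2 / p))"
    using interpolation_const_nonneg[OF p(2)] by simp
qed (use S V p in auto)

section \<open>Extension constants\<close>

text \<open>Turns truncated subtractions into the real identities needed in exponents of
  \<open>q\<close>; \<open>d = 3\<close> is the first dimension in which \<open>k\<close> is
  positive.\<close>

lemma decay_exponent:
  fixes d :: nat
  assumes "d \<ge> 3"
  shows "1 \<le> real (d - 1 - d div 2)"
    and "real (d div 2) = - real (d - 1 - d div 2) + real (d - 1)"
    and "real (d - d div 2) = real (d - 1 - d div 2) + 1"
proof -
  have "1 \<le> d - 1 - d div 2" "d div 2 + (d - 1 - d div 2) = d - 1" "d - d div 2 = d - 1 - d div 2 + 1"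
    using assms by linarith+
  then show "1 \<le> real (d - 1 - d div 2)"
    and "real (d div 2) = - real (d - 1 - d div 2) + real (d - 1)"
    and "real (d - d div 2) = real (d - 1 - d div 2) + 1"
    by (auto simp flip: of_nat_add)
qed

lemma normalized_norm_2: "normalized_norm 2 S f = sqrt ((\<Sum>x\<in>S. (cmod (f x))\<^sup>2) / card S)"
proof -
  have "0 \<le> (\<Sum>x\<in>S. (cmod (f x))\<^sup>2) / card S" by (intro divide_nonneg_nonneg sum_nonneg) auto
  then show ?thesis by (simp add: normalized_norm_def powr_half_sqrt)
qed

lemma counting_norm_ereal: "counting_norm (ereal r) V g = (\<Sum>m\<in>V. cmod (g m) powr r) powr (1 / r)"
  by (simp add: counting_norm_def)

context char_field
begin

lemma chi_dot_cnj:
  assumes "x \<in> vecs K d" "w \<in> vecs K d" "m' \<in> vecs K d"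
  shows "\<chi> (dot K d x (vec_add K d w m')) * cnj (\<chi> (dot K d x m')) = \<chi> (dot K d x w)"
proof -
  have "\<chi> (dot K d x m') * cnj (\<chi> (dot K d x m')) = 1"
    using assms by (simp flip: complex_norm_square)
  then show ?thesis using assms by (simp add: dot_add_right chi_add)
qed

lemma variety_subset: "variety K d Q \<subseteq> vecs K d"
  by (auto simp: variety_def)

lemma q_powr_bounds:
  assumes "d \<ge> 3"
  shows "3 * real q ^ (d div 2) \<le> real q ^ (d - 1)"
proof -
  have "3 * real q ^ (d div 2) \<le> real q * real q ^ (d div 2)"
    using q_ge_3 by (intro mult_right_mono) auto
  also have "\<dots> = real q ^ Suc (d div 2)" by simp
  also have "\<dots> \<le> real q ^ (d - 1)"
    using assms q_ge_3 by (intro power_increasing) linarith+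
  finally show ?thesis .
qed

text \<open>The character sum at frequency zero counts points, and \<open>q_powr_bounds\<close>
  makes its error at most a third of the main term \<open>q ^ (d - 1)\<close>.\<close>

lemma card_variety_bounds:
  assumes nd: "nondegenerate_quadratic_form K d Q" and d: "d \<ge> 3"
  shows "2 * real q ^ (d - 1) \<le> 3 * card (variety K d Q)" "card (variety K d Q) \<le> 2 * real q ^ (d - 1)"
proof -
  have "(\<Sum>x\<in>variety K d Q. \<chi> (dot K d x (vec_zero K d))) = (\<Sum>x\<in>variety K d Q. 1)"
    using variety_subset[of d Q] by (intro sum.cong refl, subst dot_eq_zero) auto
  then have "cmod (of_nat (card (variety K d Q)) - of_nat q ^ (d - 1)) \<le> real q ^ (d div 2)"
    using norm_character_sum_variety[OF nd, of "vec_zero K d"] d by (simp add: vec_zero_closed)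
  moreover have "cmod (of_nat (card (variety K d Q)) - of_nat q ^ (d - 1)) = \<bar>real (card (variety K d Q)) - real q ^ (d - 1)\<bar>"
    using norm_of_real[of "real (card (variety K d Q)) - real q ^ (d - 1)", where 'a = complex] by simp
  ultimately show "2 * real q ^ (d - 1) \<le> 3 * card (variety K d Q)" "card (variety K d Q) \<le> 2 * real q ^ (d - 1)"
    using q_powr_bounds[OF d] by linarith+
qed

lemma extension_constant_le:
  assumes nd: "nondegenerate_quadratic_form K d Q" and d: "d \<ge> 3"
  defines "k \<equiv> real (d - 1 - d div 2)"
  shows "extension_constant K \<chi> d (variety K d Q) 2 (ereal (2 * (k + 1) / k))
    \<le> ereal (sqrt (1 + interpolation_const (2 * (k + 1) / (k + 2)) * 3))"
proof -
  let ?S = "variety K d Q"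
  define n where "n = real (card ?S)"
  \<comment> \<open>Dual to \<open>2 * (k + 1) / k\<close>; the interpolation weights become
    \<open>1 / (k + 1)\<close> and \<open>k / (k + 1)\<close>.\<close>
  define p where "p = 2 * (k + 1) / (k + 2)"
  \<comment> \<open>The lower bound on \<open>n\<close> would allow 3/2. The factor 3 matches the
    bound \<open>3 * real q\<close> for the L2 constant, so the weighted product is exactly 3 and
    the powers of \<open>q\<close> cancel.\<close>
  define a where "a = 3 * real q powr (- k)"
  have k: "k \<ge> 1" unfolding k_def by (rule decay_exponent(1)[OF d])
  have q: "real q \<ge> 3" using q_ge_3 by simp
  have p: "1 < p" "p < 2" "p / (p - 1) = 2 * (k + 1) / k" "2 / p - 1 = 1 / (k + 1)" "2 - 2 / p = k / (k + 1)"
  proof -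
    have "p - 1 = k / (k + 2)" using k by (simp add: p_def field_simps)
    then show "p / (p - 1) = 2 * (k + 1) / k" using k by (simp add: p_def)
  qed (use k in \<open>auto simp: p_def field_simps\<close>)
  have a: "a > 0" using q by (simp add: a_def)
  have n: "2 * real q ^ (d - 1) \<le> 3 * n" using card_variety_bounds(1)[OF nd d] by (simp add: n_def)
  have n0: "n > 0"
  proof -
    have "0 < 2 * real q ^ (d - 1)" using q by simp
    with n show ?thesis by linarith
  qed
  have est: "(\<Sum>m\<in>vecs K d. cmod (1 / of_nat (card ?S) * (\<Sum>x\<in>?S. \<chi> (dot K d x m) * f x)) powr (p / (p - 1))) powr (1 / (p / (p - 1)))
    \<le> sqrt (1 + interpolation_const p * (a powr (2 / p - 1) * (card (vecs K d) / card ?S + 1) powr (2 - 2 / p)))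
       * sqrt ((\<Sum>x\<in>?S. (cmod (f x))\<^sup>2) / card ?S)" for f
  proof (rule extension_estimate)
    show "?S \<noteq> {}" using n0 by (auto simp: n_def)
    show "cmod (\<chi> (dot K d x m)) = 1" if "x \<in> ?S" "m \<in> vecs K d" for x m
      using that variety_subset[of d Q] by (intro norm_chi dot_closed) auto
  next
    fix m m' assume mm: "m \<in> vecs K d" "m' \<in> vecs K d"
    then obtain w where w: "w \<in> vecs K d" "m = vec_add K d w m'" "w = vec_zero K d \<longleftrightarrow> m = m'"
      by (rule vec_diff)
    have *: "\<chi> (dot K d x m) * cnj (\<chi> (dot K d x m')) = \<chi> (dot K d x w)" if "x \<in> vecs K d" for x
      using chi_dot_cnj[OF that w(1) mm(2)] w(2) by simp
    then show "(\<Sum>x\<in>vecs K d. \<chi> (dot K d x m) * cnj (\<chi> (dot K d x m'))) = (if m = m' then of_nat (card (vecs K d)) else 0)"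
      using sum_chi_dot[OF w(1)] w(3) by (simp add: card_vecs)
    assume "m \<noteq> m'"
    then have "cmod (\<Sum>x\<in>?S. \<chi> (dot K d x w)) \<le> real q ^ (d div 2)"
      using norm_character_sum_variety[OF nd _ w(1)] w(3) d by simp
    also have "(\<Sum>x\<in>?S. \<chi> (dot K d x w)) = (\<Sum>x\<in>?S. \<chi> (dot K d x m) * cnj (\<chi> (dot K d x m')))"
      using * variety_subset[of d Q] by (intro sum.cong) auto
    also have "real q ^ (d div 2) = real q powr (- k) * real q ^ (d - 1)"
    proof -
      have "real (d div 2) = - k + real (d - 1)" unfolding k_def by (rule decay_exponent(2)[OF d])
      then show ?thesis using q by (simp flip: powr_realpow powr_add)
    qed
    also have "\<dots> \<le> real q powr (- k) * (3 * n)"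
      using n n0 by (intro mult_left_mono) auto
    finally show "cmod (\<Sum>x\<in>?S. \<chi> (dot K d x m) * cnj (\<chi> (dot K d x m'))) \<le> a * card ?S"
      by (simp add: a_def n_def mult_ac)
  qed (use variety_subset p a in \<open>auto simp: finite_vecs\<close>)
  have "card (vecs K d) / card ?S \<le> 3 / 2 * real q"
  proof -
    have "real (card (vecs K d)) = real q * real q ^ (d - 1)"
      using d by (simp add: card_vecs flip: power_Suc)
    also have "\<dots> \<le> real q * (3 / 2 * n)" using n by (intro mult_left_mono) auto
    finally show ?thesis using n0 by (simp add: n_def[symmetric] field_simps)
  qed
  then have b: "card (vecs K d) / card ?S + 1 \<le> 3 * real q" using q by linarith
  have "a powr (2 / p - 1) * (card (vecs K d) / card ?S + 1) powr (2 - 2 / p)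
     \<le> a powr (1 / (k + 1)) * (3 * real q) powr (k / (k + 1))"
    unfolding p using b k by (intro mult_left_mono powr_mono2) auto
  also have "\<dots> = 3 powr (1 / (k + 1) + k / (k + 1)) * real q powr (- k * (1 / (k + 1)) + k / (k + 1))"
    unfolding a_def powr_mult powr_powr powr_add by simp
  also have "\<dots> = 3 powr 1 * real q powr 0"
    using k by (intro arg_cong2[of _ _ _ _ "\<lambda>x y. 3 powr x * real q powr y"]) (auto simp: field_simps)
  finally have "a powr (2 / p - 1) * (card (vecs K d) / card ?S + 1) powr (2 - 2 / p) \<le> 3"
    using q by simp
  then have le: "sqrt (1 + interpolation_const p * (a powr (2 / p - 1) * (card (vecs K d) / card ?S + 1) powr (2 - 2 / p)))
     \<le> sqrt (1 + interpolation_const p * 3)"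
    using interpolation_const_nonneg[OF p(2)] by (intro real_sqrt_le_mono add_left_mono mult_left_mono) auto
  have "counting_norm (ereal (2 * (k + 1) / k)) (vecs K d) (extension_operator K \<chi> d ?S f)
      \<le> sqrt (1 + interpolation_const p * 3) * normalized_norm 2 ?S f" for f
  proof -
    have "0 \<le> (\<Sum>x\<in>?S. (cmod (f x))\<^sup>2) / card ?S" by (intro divide_nonneg_nonneg sum_nonneg) auto
    then show ?thesis
      unfolding counting_norm_ereal normalized_norm_2 extension_operator_def p(3)[symmetric]
      using le by (intro order_trans[OF est] mult_right_mono) auto
  qed
  then show ?thesis unfolding extension_constant_def p_def[symmetric]
    using interpolation_const_nonneg[OF p(2)] by (intro Inf_lower imageI) auto
qed

end

text \<open>The form \<open>x\<^sub>0 x\<^sub>e + \<dots> + x\<^bsub>e-1\<^esub> x\<^bsub>2e-1\<^esub>\<close> with \<open>e = d div 2\<close>, plus \<open>x\<^bsub>2e\<^esub>\<^sup>2\<close> if \<open>d\<close> is odd, has a totally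
  isotropic subspace of the largest possible dimension \<open>e\<close>.\<close>

definition split_coeff :: "('a, 'b) ring_scheme \<Rightarrow> nat \<Rightarrow> nat \<Rightarrow> nat \<Rightarrow> 'a" where
  "split_coeff K d i j =
     (if i < d div 2 \<and> j = i + d div 2 \<or> i = 2 * (d div 2) \<and> j = i then \<one>\<^bsub>K\<^esub> else \<zero>\<^bsub>K\<^esub>)"

definition split_form :: "('a, 'b) ring_scheme \<Rightarrow> nat \<Rightarrow> (nat \<Rightarrow> 'a) \<Rightarrow> 'a" where
  "split_form K d x = (\<Oplus>\<^bsub>K\<^esub>i\<in>{..<d}. \<Oplus>\<^bsub>K\<^esub>j\<in>{..<d}. split_coeff K d i j \<otimes>\<^bsub>K\<^esub> x i \<otimes>\<^bsub>K\<^esub> x j)"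

section \<open>The split form and the lower bound\<close>

context char_field
begin

lemma split_coeff_closed: "split_coeff K d i j \<in> carrier K"
  by (simp add: split_coeff_def)

lemma nondegenerate_split_form: "nondegenerate_quadratic_form K d (split_form K d)"
  unfolding nondegenerate_quadratic_form_def
proof (intro conjI ballI impI)
  show qf: "quadratic_form K d (split_form K d)"
    unfolding quadratic_form_def
    by (intro exI[of _ "split_coeff K d"]) (auto simp: split_coeff_closed split_form_def)
  fix x assume x: "x \<in> vecs K d" "\<forall>y\<in>vecs K d. polar_form K d (split_form K d) x y = \<zero>"
  interpret quad_space K \<chi> "vec_module K d" "split_form K d" "polar_form K d (split_form K d)"
    by (rule quad_space_vec_module(1)[OF qf])
  define e where "e = d div 2"
  let ?c = "split_coeff K d"
  \<comment> \<open>Testing against unit vectors: a vector of the radical is annihilated by the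
    coefficient matrix plus its transpose.\<close>
  have eq: "dot K d (?c i) x \<oplus> dot K d (\<lambda>j. ?c j i) x = \<zero>" if "i < d" for i
  proof -
    let ?v = "vec_add K d (mat_vec d ?c x) (mat_vec d (\<lambda>i j. ?c j i) x)"
    have v: "?v \<in> vecs K d"
      using x split_coeff_closed by (intro vec_add_closed mat_vec_closed) auto
    have "\<zero> = polar_form K d (split_form K d) (unit_vec K d i) x"
      using x B_sym[of x "unit_vec K d i"] by (simp add: unit_vec_closed)
    also have "\<dots> = dot K d (unit_vec K d i) ?v"
      using x split_coeff_closed by (intro polar_form_eq_dot(2)) (auto simp: split_form_def unit_vec_closed)
    also have "\<dots> = dot K d (?c i) x \<oplus> dot K d (\<lambda>j. ?c j i) x"
      using that by (simp add: dot_unit_left[OF v])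
    finally show ?thesis by simp
  qed
  have "x i = \<zero>" if "i < d" for i
  proof -
    \<comment> \<open>The row of the partner index \<open>i + e\<close> or \<open>i - e\<close>
      isolates \<open>x i\<close>. The index \<open>2 * e\<close> occurs only for odd
      \<open>d\<close>, is its own partner and requires 2 to be invertible.\<close>
    consider "i < e" | "e \<le> i" "i < 2 * e" | "i = 2 * e" using \<open>i < d\<close> unfolding e_def by linarith
    then show ?thesis
    proof cases
      case 1
      then have "i + e < d" by (simp add: e_def)
      moreover have "dot K d (?c (i + e)) x = \<zero>"
        using 1 x by (intro dot_eq_zero) (auto simp: split_coeff_def e_def)
      moreover have "dot K d (\<lambda>j. ?c j (i + e)) x = x i"
        using 1 x \<open>i < d\<close> by (intro dot_delta) (auto simp: split_coeff_def e_def)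
      ultimately show ?thesis using eq[of "i + e"] x \<open>i < d\<close> by simp
    next
      case 2
      then have "i - e < d" "i - e < e" by (auto simp: e_def)
      moreover have "dot K d (?c (i - e)) x = x i"
        using 2 x \<open>i < d\<close> by (intro dot_delta) (auto simp: split_coeff_def e_def)
      moreover have "dot K d (\<lambda>j. ?c j (i - e)) x = \<zero>"
        using 2 x by (intro dot_eq_zero) (auto simp: split_coeff_def e_def)
      ultimately show ?thesis using eq[of "i - e"] x \<open>i < d\<close> by simp
    next
      case 3
      have "dot K d (?c i) x = x i" "dot K d (\<lambda>j. ?c j i) x = x i"
        using 3 x \<open>i < d\<close> by (auto intro!: dot_delta simp: split_coeff_def e_def)
      then have "(\<one> \<oplus> \<one>) \<otimes> x i = \<zero>" using eq[of i] x \<open>i < d\<close> by (simp add: l_distr)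
      then show ?thesis using integral[of "\<one> \<oplus> \<one>" "x i"] two_nonzero x \<open>i < d\<close> by auto
    qed
  qed
  then show "x = vec_zero K d"
    using x by (intro vecs_ext[of _ K d]) (auto simp: vec_zero_closed)
qed

text \<open>Every monomial of the form contains a variable of index at least
  \<open>d div 2\<close>.\<close>

lemma split_form_eq_zero:
  assumes x: "x \<in> vecs K d" "\<And>i. d div 2 \<le> i \<Longrightarrow> i < d \<Longrightarrow> x i = \<zero>"
  shows "split_form K d x = \<zero>"
proof -
  have 0: "split_coeff K d i j \<otimes> x i \<otimes> x j = \<zero>" if "i < d" "j < d" for i j
    using x that split_coeff_closed[of d i j] by (auto simp: split_coeff_def)
  have "split_form K d x = (\<Oplus>i\<in>{..<d}. \<Oplus>j\<in>{..<d}. \<zero>)"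
    unfolding split_form_def using 0 by (intro finsum_cong' refl) auto
  then show ?thesis by (simp add: finsum_zero)
qed

lemma card_coordinate_subspace:
  "card {x \<in> vecs K d. \<forall>i<d. P i \<longrightarrow> x i = \<zero>} = q ^ card {i. i < d \<and> \<not> P i}"
proof -
  have "{x \<in> vecs K d. \<forall>i<d. P i \<longrightarrow> x i = \<zero>} = (\<Pi>\<^sub>E i\<in>{..<d}. if P i then {\<zero>} else carrier K)"
  proof -
    have "t \<in> (if P i then {\<zero>} else carrier K) \<longleftrightarrow> t \<in> carrier K \<and> (P i \<longrightarrow> t = \<zero>)" for t i
      by auto
    then show ?thesis unfolding vecs_def PiE_iff set_eq_iff mem_Collect_eq by (simp only:) blast
  qed
  also have "card \<dots> = (\<Prod>i\<in>{..<d}. if P i then 1 else q)"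
    by (subst card_PiE) (auto intro!: prod.cong)
  also have "\<dots> = q ^ card {i. i < d \<and> \<not> P i}"
  proof -
    have "{..<d} \<inter> - {i. P i} = {i. i < d \<and> \<not> P i}" by auto
    then show ?thesis by (simp add: prod.If_cases)
  qed
  finally show ?thesis .
qed

text \<open>The indicator function of the isotropic \<open>H\<close> has norm
  \<open>sqrt \<rho>\<close> and extension \<open>\<rho>\<close> on \<open>H'\<close>, where
  \<open>\<rho> = card H / n\<close>, so the constant is at least
  \<open>card H' powr (1 / r) * sqrt \<rho>\<close>. The \<open>sqrt 2\<close> comes from the upper
  bound on the number of points.\<close>

lemma extension_constant_split_form_ge:
  assumes d: "d \<ge> 3" and r: "r \<ge> 1"
  defines "k \<equiv> real (d - 1 - d div 2)"
  shows "ereal (real q powr ((k + 1) / r - k / 2) / sqrt 2)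
    \<le> extension_constant K \<chi> d (variety K d (split_form K d)) 2 (ereal r)"
  unfolding extension_constant_def
proof (rule Inf_greatest)
  let ?S = "variety K d (split_form K d)"
  fix z
  assume "z \<in> ereal ` {C. 0 \<le> C \<and> (\<forall>f. counting_norm (ereal r) (vecs K d) (extension_operator K \<chi> d ?S f)
                               \<le> C * normalized_norm 2 ?S f)}"
  then obtain C where C: "z = ereal C" "0 \<le> C"
    "\<And>f. counting_norm (ereal r) (vecs K d) (extension_operator K \<chi> d ?S f) \<le> C * normalized_norm 2 ?S f"
    by blast
  define n where "n = real (card ?S)"
  define e where "e = d div 2"
  have q: "real q \<ge> 3" using q_ge_3 by simp
  have n: "2 * real q ^ (d - 1) \<le> 3 * n" "n \<le> 2 * real q ^ (d - 1)"
    using card_variety_bounds[OF nondegenerate_split_form d] by (simp_all add: n_def)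
  have n0: "n > 0"
  proof -
    have "0 < 2 * real q ^ (d - 1)" using q by simp
    with n(1) show ?thesis by linarith
  qed
  have fin: "finite ?S" using variety_subset finite_vecs[OF finite_K] by (rule finite_subset)
  define H where "H = {x \<in> vecs K d. \<forall>i<d. e \<le> i \<longrightarrow> x i = \<zero>}"
  \<comment> \<open>The annihilator of \<open>H\<close> for \<open>dot\<close>, not for the polar
    form: \<open>H\<close> lives on the first \<open>e\<close> coordinates and \<open>H'\<close> on
    the others.\<close>
  define H' where "H' = {x \<in> vecs K d. \<forall>i<d. i < e \<longrightarrow> x i = \<zero>}"
  have "{i. i < d \<and> \<not> e \<le> i} = {..<e}" "{i. i < d \<and> \<not> i < e} = {e..<d}" by (auto simp: e_def)
  then have card_H: "card H = q ^ e" "card H' = q ^ (d - e)"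
    unfolding H_def H'_def card_coordinate_subspace by simp_all
  have HS: "H \<subseteq> ?S" unfolding H_def variety_def e_def by (auto intro!: split_form_eq_zero)
  define f where "f x = (if x \<in> H then 1 else 0 :: complex)" for x
  define \<rho> where "\<rho> = real (card H) / n"
  have \<rho>: "\<rho> > 0" unfolding \<rho>_def using n0 q by (simp add: card_H)
  have ext: "extension_operator K \<chi> d ?S f m = of_real \<rho>" if m: "m \<in> H'" for m
  proof -
    have "\<chi> (dot K d x m) = 1" if "x \<in> H" for x
    proof -
      have "x i \<otimes> m i = \<zero>" if "i < d" for i
      proof (cases "i < e")
        case True
        then show ?thesis using m \<open>x \<in> H\<close> that by (auto simp: H_def H'_def)
      next
        case False
        then show ?thesis using m \<open>x \<in> H\<close> that by (auto simp: H_def H'_def)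
      qed
      then show ?thesis by (subst dot_eq_zero) auto
    qed
    then have "(\<Sum>x\<in>?S. \<chi> (dot K d x m) * f x) = (\<Sum>x\<in>H. 1)"
      using HS fin by (intro sum.mono_neutral_cong_right) (auto simp: f_def)
    then show ?thesis by (simp add: extension_operator_def \<rho>_def n_def)
  qed
  have "real q powr ((k + 1) / r) * \<rho> = (real (card H') * \<rho> powr r) powr (1 / r)"
  proof -
    have "real (card H') = real q powr (k + 1)"
    proof -
      have "real (d - e) = k + 1" unfolding k_def e_def by (rule decay_exponent(3)[OF d])
      then show ?thesis using q by (simp add: card_H flip: powr_realpow)
    qed
    then show ?thesis using r \<rho> q by (simp add: powr_mult powr_powr)
  qed
  also have "real (card H') * \<rho> powr r = (\<Sum>m\<in>H'. cmod (extension_operator K \<chi> d ?S f m) powr r)"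
    using \<rho> by (simp add: ext)
  also have "\<dots> powr (1 / r) \<le> counting_norm (ereal r) (vecs K d) (extension_operator K \<chi> d ?S f)"
    unfolding counting_norm_ereal using r finite_vecs[OF finite_K]
    by (intro powr_mono2 sum_mono2 sum_nonneg) (auto simp: H'_def)
  also have "\<dots> \<le> C * normalized_norm 2 ?S f" by (rule C(3))
  also have "normalized_norm 2 ?S f = sqrt \<rho>"
  proof -
    have "(\<Sum>x\<in>?S. (cmod (f x))\<^sup>2) = (\<Sum>x\<in>H. 1)"
      using HS fin by (intro sum.mono_neutral_cong_right) (auto simp: f_def)
    then show ?thesis unfolding normalized_norm_2 \<rho>_def n_def by simp
  qed
  finally have "real q powr ((k + 1) / r) * sqrt \<rho> * sqrt \<rho> \<le> C * sqrt \<rho>"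
    by (simp only: mult.assoc real_sqrt_mult_self abs_of_pos[OF \<rho>])
  then have "real q powr ((k + 1) / r) * sqrt \<rho> \<le> C"
    using \<rho> by (simp only: mult_le_cancel_right_pos real_sqrt_gt_0_iff)
  moreover have "real q powr (- k / 2) / sqrt 2 \<le> sqrt \<rho>"
  proof -
    have "real q powr (- k) = real q ^ e / real q ^ (d - 1)"
    proof -
      have "- k = real e - real (d - 1)" unfolding k_def e_def using decay_exponent(2)[OF d] by simp
      then show ?thesis using q by (simp add: powr_diff powr_realpow)
    qed
    then have "real q powr (- k) / 2 = real q ^ e / (2 * real q ^ (d - 1))" by simp
    also have "\<dots> \<le> \<rho>"
      unfolding \<rho>_def card_H of_nat_power using n n0 q by (intro divide_left_mono mult_pos_pos) auto
    finally have "sqrt (real q powr (- k) / 2) \<le> sqrt \<rho>" by (rule real_sqrt_le_mono)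
    moreover have "sqrt (real q powr (- k)) = real q powr (- k / 2)"
      by (simp add: powr_half_sqrt[symmetric] powr_powr)
    ultimately show ?thesis by (simp add: real_sqrt_divide)
  qed
  then have "real q powr ((k + 1) / r) * (real q powr (- k / 2) / sqrt 2) \<le> real q powr ((k + 1) / r) * sqrt \<rho>"
    by (intro mult_left_mono) auto
  moreover have "real q powr ((k + 1) / r) * (real q powr (- k / 2) / sqrt 2) = real q powr ((k + 1) / r - k / 2) / sqrt 2"
    by (simp flip: powr_add)
  ultimately show "ereal (real q powr ((k + 1) / r - k / 2) / sqrt 2) \<le> z"
    using C(1) by simp
qed

end

section \<open>Uniformity in the field and the two parities of the dimension\<close>

lemma char_fieldI:
  assumes "odd_prime_power q" "finite_field q K" "nontrivial_additive_character K \<chi>"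
  shows "char_field K \<chi>"
  using assms unfolding char_field_def char_field_axioms_def finite_field_def odd_prime_power_def by auto

lemma ex_odd_prime_power_powr_ge:
  fixes \<delta> B :: real
  assumes "\<delta> > 0"
  shows "\<exists>q. odd_prime_power q \<and> B \<le> real q powr \<delta>"
proof -
  obtain p where p: "prime p" "p > max 2 (nat \<lceil>\<bar>B\<bar> powr (1 / \<delta>)\<rceil>)"
    using bigger_prime by blast
  have "odd_prime_power p"
    using p prime_odd_nat[of p] by (auto simp: odd_prime_power_def)
  moreover have "\<bar>B\<bar> powr (1 / \<delta>) \<le> real p" using p(2) by linarith
  then have "(\<bar>B\<bar> powr (1 / \<delta>)) powr \<delta> \<le> real p powr \<delta>"
    using assms by (intro powr_mono2) auto
  then have "B \<le> real p powr \<delta>" using assms by (simp add: powr_powr)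
  ultimately show ?thesis by blast
qed

text \<open>Below the critical exponent \<open>(k + 1) / r - k / 2\<close> is positive, so the lower
  bound is unbounded along the primes.\<close>

lemma SUP_extension_constant_split_form:
  fixes F :: "nat \<Rightarrow> ('a, 'b) ring_scheme" and \<chi> :: "nat \<Rightarrow> 'a \<Rightarrow> complex"
  assumes F: "\<And>q. odd_prime_power q \<Longrightarrow> finite_field q (F q) \<and> nontrivial_additive_character (F q) (\<chi> q)"
    and d: "d \<ge> 3" and r: "1 \<le> r" "r < 2 * (k + 1) / k" and k: "k = real (d - 1 - d div 2)"
  shows "(SUP q\<in>{q. odd_prime_power q}.
    extension_constant (F q) (\<chi> q) d (variety (F q) d (split_form (F q) d)) 2 (ereal r)) = \<infinity>"
proof (rule SUP_PInfty)
  fix n :: nat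
  have k1: "k \<ge> 1" unfolding k by (rule decay_exponent(1)[OF d])
  have "(k + 1) / r - k / 2 > 0" using k1 r by (simp add: field_simps)
  then obtain q where q: "odd_prime_power q" "sqrt 2 * real n \<le> real q powr ((k + 1) / r - k / 2)"
    using ex_odd_prime_power_powr_ge by blast
  interpret char_field "F q" "\<chi> q"
    using F[OF q(1)] char_fieldI[OF q(1)] by blast
  have "card (carrier (F q)) = q" using F[OF q(1)] by (simp add: finite_field_def)
  then have "ereal (real q powr ((k + 1) / r - k / 2) / sqrt 2)
    \<le> extension_constant (F q) (\<chi> q) d (variety (F q) d (split_form (F q) d)) 2 (ereal r)"
    using extension_constant_split_form_ge[OF d r(1)] by (simp add: k)
  moreover have "ereal (real n) \<le> ereal (real q powr ((k + 1) / r - k / 2) / sqrt 2)"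
    using q(2) by (simp add: field_simps)
  ultimately have "ereal (real n) \<le> extension_constant (F q) (\<chi> q) d (variety (F q) d (split_form (F q) d)) 2 (ereal r)"
    by (rule order_trans[rotated])
  with q(1) show "\<exists>q\<in>{q. odd_prime_power q}. ereal (real n)
     \<le> extension_constant (F q) (\<chi> q) d (variety (F q) d (split_form (F q) d)) 2 (ereal r)"
    by blast
qed

lemma exponent_odd:
  assumes "odd d" "d \<ge> 3"
  shows "2 * (real (d - 1 - d div 2) + 1) / real (d - 1 - d div 2) = (2 * real d + 2) / (real d - 1)"
proof -
  from assms(1) obtain h where h: "d = 2 * h + 1" by (rule oddE)
  with assms(2) have "h \<ge> 1" by simp
  with h show ?thesis by (simp add: field_simps)
qed

lemma exponent_even:
  assumes "even d" "d \<ge> 4"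
  shows "2 * (real (d - 1 - d div 2) + 1) / real (d - 1 - d div 2) = 2 * real d / (real d - 2)"
proof -
  from assms(1) obtain h where h: "d = 2 * h" by (rule evenE)
  with assms(2) have "h \<ge> 2" by simp
  moreover from this have "real (2 * h - 1 - h) = real h - 1" by (simp add: of_nat_diff)
  ultimately show ?thesis using h by (simp add: field_simps)
qed

text \<open>The exponent enters through an equation, so that both parities share the argument; the
  witness is built from \<open>d\<close> alone.\<close>

lemma ex_extension_constant_le:
  fixes d :: nat
  assumes d: "d \<ge> 3" and r: "2 * (real (d - 1 - d div 2) + 1) / real (d - 1 - d div 2) = r"
  shows "\<exists>C::real. \<forall>q (K::('a, 'b) ring_scheme) \<chi> Q.
           odd_prime_power q \<and> finite_field q K \<and> nontrivial_additive_character K \<chi> \<and>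
           nondegenerate_quadratic_form K d Q \<longrightarrow>
           extension_constant K \<chi> d (variety K d Q) 2 (ereal r) \<le> ereal C"
proof (rule exI, intro allI impI, elim conjE)
  fix q \<chi> Q and K :: "('a, 'b) ring_scheme"
  assume h: "odd_prime_power q" "finite_field q K" "nontrivial_additive_character K \<chi>" "nondegenerate_quadratic_form K d Q"
  interpret char_field K \<chi> using h(1-3) by (rule char_fieldI)
  show "extension_constant K \<chi> d (variety K d Q) 2 (ereal r) \<le> ereal (sqrt (1 + interpolation_const
     (2 * (real (d - 1 - d div 2) + 1) / (real (d - 1 - d div 2) + 2)) * 3))"
    using extension_constant_le[OF h(4) d] unfolding r .
qed

lemma ex_sharp_form:
  fixes F :: "nat \<Rightarrow> ('a, 'b) ring_scheme" and \<chi> :: "nat \<Rightarrow> 'a \<Rightarrow> complex"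
  assumes F: "\<forall>q. odd_prime_power q \<longrightarrow> finite_field q (F q) \<and> nontrivial_additive_character (F q) (\<chi> q)"
    and d: "d \<ge> 3" and r: "2 * (real (d - 1 - d div 2) + 1) / real (d - 1 - d div 2) = r\<^sub>0"
  shows "\<exists>Q. (\<forall>q. odd_prime_power q \<longrightarrow> nondegenerate_quadratic_form (F q) d (Q q)) \<and>
    (\<forall>r::real. 1 \<le> r \<and> r < r\<^sub>0 \<longrightarrow>
       (SUP q\<in>{q. odd_prime_power q}. extension_constant (F q) (\<chi> q) d (variety (F q) d (Q q)) 2 (ereal r)) = \<infinity>)"
proof (intro exI[of _ "\<lambda>q. split_form (F q) d"] conjI allI impI)
  fix q assume "odd_prime_power q"
  then interpret char_field "F q" "\<chi> q" using F char_fieldI by blast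
  show "nondegenerate_quadratic_form (F q) d (split_form (F q) d)" by (rule nondegenerate_split_form)
next
  fix r :: real assume "1 \<le> r \<and> r < r\<^sub>0"
  then show "(SUP q\<in>{q. odd_prime_power q}.
      extension_constant (F q) (\<chi> q) d (variety (F q) d (split_form (F q) d)) 2 (ereal r)) = \<infinity>"
    using F d assms(3) by (intro SUP_extension_constant_split_form[OF _ d _ _ refl]) auto
qed

theorem theorem2p1:
  shows
    "(\<forall>d::nat. odd d \<and> d \<ge> 3 \<longrightarrow>
        (\<exists>C::real. \<forall>q (K::'a ring) \<chi> Q.
           odd_prime_power q \<and> finite_field q K \<and> nontrivial_additive_character K \<chi> \<and>
           nondegenerate_quadratic_form K d Q \<longrightarrow>
           extension_constant K \<chi> d (variety K d Q) 2 (ereal ((2 * real d + 2) / (real d - 1)))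
             \<le> ereal C)) \<and>
     (\<forall>d::nat. even d \<and> d \<ge> 4 \<longrightarrow>
        (\<exists>C::real. \<forall>q (K::'a ring) \<chi> Q.
           odd_prime_power q \<and> finite_field q K \<and> nontrivial_additive_character K \<chi> \<and>
           nondegenerate_quadratic_form K d Q \<longrightarrow>
           extension_constant K \<chi> d (variety K d Q) 2 (ereal (2 * real d / (real d - 2)))
             \<le> ereal C)) \<and>
     (\<forall>(F::nat \<Rightarrow> 'a ring) (\<chi>::nat \<Rightarrow> 'a \<Rightarrow> complex).
        (\<forall>q. odd_prime_power q \<longrightarrow>
           finite_field q (F q) \<and> nontrivial_additive_character (F q) (\<chi> q)) \<longrightarrow>
        (\<forall>d::nat. odd d \<and> d \<ge> 3 \<longrightarrow>
           (\<exists>Q. (\<forall>q. odd_prime_power q \<longrightarrow> nondegenerate_quadratic_form (F q) d (Q q)) \<and>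
              (\<forall>r::real. 1 \<le> r \<and> r < (2 * real d + 2) / (real d - 1) \<longrightarrow>
                 (SUP q\<in>{q. odd_prime_power q}.
                    extension_constant (F q) (\<chi> q) d (variety (F q) d (Q q)) 2 (ereal r)) = \<infinity>))) \<and>
        (\<forall>d::nat. even d \<and> d \<ge> 4 \<longrightarrow>
           (\<exists>Q. (\<forall>q. odd_prime_power q \<longrightarrow> nondegenerate_quadratic_form (F q) d (Q q)) \<and>
              (\<forall>r::real. 1 \<le> r \<and> r < 2 * real d / (real d - 2) \<longrightarrow>
                 (SUP q\<in>{q. odd_prime_power q}.
                    extension_constant (F q) (\<chi> q) d (variety (F q) d (Q q)) 2 (ereal r)) = \<infinity>))))"
proof (intro conjI allI impI)
  fix d :: nat
  assume d: "odd d \<and> d \<ge> 3"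
  then show "\<exists>C::real. \<forall>q (K::'a ring) \<chi> Q.
       odd_prime_power q \<and> finite_field q K \<and> nontrivial_additive_character K \<chi> \<and>
       nondegenerate_quadratic_form K d Q \<longrightarrow>
       extension_constant K \<chi> d (variety K d Q) 2 (ereal ((2 * real d + 2) / (real d - 1))) \<le> ereal C"
    by (intro ex_extension_constant_le exponent_odd) auto
next
  fix d :: nat
  assume d: "even d \<and> d \<ge> 4"
  then show "\<exists>C::real. \<forall>q (K::'a ring) \<chi> Q.
       odd_prime_power q \<and> finite_field q K \<and> nontrivial_additive_character K \<chi> \<and>
       nondegenerate_quadratic_form K d Q \<longrightarrow>
       extension_constant K \<chi> d (variety K d Q) 2 (ereal (2 * real d / (real d - 2))) \<le> ereal C"
    by (intro ex_extension_constant_le exponent_even) auto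
next
  fix F :: "nat \<Rightarrow> 'a ring" and \<chi> :: "nat \<Rightarrow> 'a \<Rightarrow> complex" and d :: nat
  assume F: "\<forall>q. odd_prime_power q \<longrightarrow> finite_field q (F q) \<and> nontrivial_additive_character (F q) (\<chi> q)"
    and d: "odd d \<and> d \<ge> 3"
  from d show "\<exists>Q. (\<forall>q. odd_prime_power q \<longrightarrow> nondegenerate_quadratic_form (F q) d (Q q)) \<and>
      (\<forall>r::real. 1 \<le> r \<and> r < (2 * real d + 2) / (real d - 1) \<longrightarrow>
         (SUP q\<in>{q. odd_prime_power q}.
            extension_constant (F q) (\<chi> q) d (variety (F q) d (Q q)) 2 (ereal r)) = \<infinity>)"
    by (intro ex_sharp_form[OF F] exponent_odd) auto
next
  fix F :: "nat \<Rightarrow> 'a ring" and \<chi> :: "nat \<Rightarrow> 'a \<Rightarrow> complex" and d :: nat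
  assume F: "\<forall>q. odd_prime_power q \<longrightarrow> finite_field q (F q) \<and> nontrivial_additive_character (F q) (\<chi> q)"
    and d: "even d \<and> d \<ge> 4"
  from d show "\<exists>Q. (\<forall>q. odd_prime_power q \<longrightarrow> nondegenerate_quadratic_form (F q) d (Q q)) \<and>
      (\<forall>r::real. 1 \<le> r \<and> r < 2 * real d / (real d - 2) \<longrightarrow>
         (SUP q\<in>{q. odd_prime_power q}.
            extension_constant (F q) (\<chi> q) d (variety (F q) d (Q q)) 2 (ereal r)) = \<infinity>)"
    by (intro ex_sharp_form[OF F] exponent_even) auto
qed

end
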